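(* On a Real RAM, for an embedded, vertex-weighted star $S$ it can be decided in linear time whether $S$ has a weighted disk contact representation respecting the embedding, and such a representation (if one exists) can be constructed in linear time.
   Context: A disk contact representation of a graph $G=(V,E)$ is a set of interior-disjoint closed disks in the plane together with a bijection between $V$ and the disks such that two disks touch if and only if the corresponding vertices are adjacent. Given positive vertex weights $w(v)$, a weighted disk contact representation is one in which the disk representing each vertex $v$ has radius proportional to $w(v)$. A star is a tree consisting of one central vertex adjacent to all other vertices (leaves). The star is embedded if a cyclic order of the leaves around the central vertex is prescribed; a representation respects the embedding if the leaf disks touch the central disk in this cyclic order. The Real RAM model assumes that basic arithmetic operations, including square roots and trigonometric functions, on real numbers take constant time. *)

theory Defs
  imports "HOL-Analysis.Analysis"
begin

datatype instr =
    Const nat int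
  | Copy nat nat
  | Add nat nat nat
  | Sub nat nat nat
  | Mul nat nat nat
  | Div nat nat nat
  | Sqrt nat nat
  | Sin nat nat
  | Cos nat nat
  | Arctan nat nat
  | Arcsin nat nat
  | Load nat nat
  | Store nat nat
  | JLeq nat nat nat
  | Halt

type_synonym ram_state = "nat \<times> (nat \<Rightarrow> real)"

definition halted :: "instr list \<Rightarrow> ram_state \<Rightarrow> bool" where
  "halted P s \<longleftrightarrow> length P \<le> fst s"

fun step :: "instr list \<Rightarrow> ram_state \<Rightarrow> ram_state option" where
  "step P (pc, m) =
    (if length P \<le> pc then Some (pc, m) else
     (case P ! pc of
        Const d c \<Rightarrow> Some (Suc pc, m(d := of_int c))
      | Copy d a \<Rightarrow> Some (Suc pc, m(d := m a))
      | Add d a b \<Rightarrow> Some (Suc pc, m(d := m a + m b))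
      | Sub d a b \<Rightarrow> Some (Suc pc, m(d := m a - m b))
      | Mul d a b \<Rightarrow> Some (Suc pc, m(d := m a * m b))
      | Div d a b \<Rightarrow> (if m b = 0 then None else Some (Suc pc, m(d := m a / m b)))
      | Sqrt d a \<Rightarrow> (if m a < 0 then None else Some (Suc pc, m(d := sqrt (m a))))
      | Sin d a \<Rightarrow> Some (Suc pc, m(d := sin (m a)))
      | Cos d a \<Rightarrow> Some (Suc pc, m(d := cos (m a)))
      | Arctan d a \<Rightarrow> Some (Suc pc, m(d := arctan (m a)))
      | Arcsin d a \<Rightarrow> (if \<bar>m a\<bar> \<le> 1 then Some (Suc pc, m(d := arcsin (m a))) else None)
      | Load d a \<Rightarrow> (if m a \<in> \<nat> then Some (Suc pc, m(d := m (nat \<lfloor>m a\<rfloor>))) else None)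
      | Store a s \<Rightarrow> (if m a \<in> \<nat> then Some (Suc pc, m(nat \<lfloor>m a\<rfloor> := m s)) else None)
      | JLeq a b t \<Rightarrow> Some (if m a \<le> m b then t else Suc pc, m)
      | Halt \<Rightarrow> Some (length P, m)))"

primrec exec :: "instr list \<Rightarrow> nat \<Rightarrow> ram_state \<Rightarrow> ram_state option" where
  "exec P 0 s = Some s"
| "exec P (Suc k) s = (case step P s of None \<Rightarrow> None | Some s' \<Rightarrow> exec P k s')"

text \<open>A star with n leaves: vertex 0 is the centre, vertices 1..n are the leaves,
whose prescribed cyclic (counterclockwise) order is 1, 2, ..., n. Weights w i for i \<le> n.
A representation assigns to vertex i the closed disk cball (c i) (r i).\<close>

definition star_wdcr :: "nat \<Rightarrow> (nat \<Rightarrow> real) \<Rightarrow> (nat \<Rightarrow> complex) \<Rightarrow> (nat \<Rightarrow> real) \<Rightarrow> bool" where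
  "star_wdcr n w c r \<longleftrightarrow>
     (\<exists>s>0. \<forall>i\<le>n. r i = s * w i) \<and>
     (\<forall>i\<le>n. \<forall>j\<le>n. i \<noteq> j \<longrightarrow> ball (c i) (r i) \<inter> ball (c j) (r j) = {}) \<and>
     (\<forall>i\<le>n. \<forall>j\<le>n. i \<noteq> j \<longrightarrow>
        (cball (c i) (r i) \<inter> cball (c j) (r j) \<noteq> {} \<longleftrightarrow> i = 0 \<or> j = 0))"

definition respects_embedding :: "nat \<Rightarrow> (nat \<Rightarrow> complex) \<Rightarrow> (nat \<Rightarrow> real) \<Rightarrow> bool" where
  "respects_embedding n c r \<longleftrightarrow>
     (\<exists>\<theta> :: nat \<Rightarrow> real.
        (\<forall>i. 1 \<le> i \<and> i < n \<longrightarrow> \<theta> i < \<theta> (Suc i)) \<and>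
        (1 \<le> n \<longrightarrow> \<theta> n < \<theta> 1 + 2 * pi) \<and>
        (\<forall>i. 1 \<le> i \<and> i \<le> n \<longrightarrow> c i = c 0 + complex_of_real (r 0 + r i) * cis (\<theta> i)))"

definition has_star_rep :: "nat \<Rightarrow> (nat \<Rightarrow> real) \<Rightarrow> bool" where
  "has_star_rep n w \<longleftrightarrow> (\<exists>c r. star_wdcr n w c r \<and> respects_embedding n c r)"

definition star_input :: "nat \<Rightarrow> (nat \<Rightarrow> real) \<Rightarrow> ram_state" where
  "star_input n w = (0, \<lambda>j. if j = 0 then real n else if j \<le> Suc n then w (j - 1) else 0)"

definition star_output_correct :: "nat \<Rightarrow> (nat \<Rightarrow> real) \<Rightarrow> (nat \<Rightarrow> real) \<Rightarrow> bool" where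
  "star_output_correct n w m \<longleftrightarrow>
     (if has_star_rep n w then
        m 0 = 1 \<and>
        (let c = (\<lambda>i. Complex (m (3*i+1)) (m (3*i+2))); r = (\<lambda>i. m (3*i+3))
         in star_wdcr n w c r \<and> respects_embedding n c r)
      else m 0 = 0)"

end

theory Submission
  imports Defs
begin

text \<open>
  With \<open>a\<^sub>i = sqrt (w\<^sub>i / (w\<^sub>0 + w\<^sub>i))\<close>, leaves \<open>i\<close> and \<open>j\<close> touch exactly when they are seen from the
  centre under the angle \<open>2 arcsin (a\<^sub>i a\<^sub>j)\<close>. A representation is therefore a solution of a cyclic
  system of strict difference constraints on the directions of the leaves. Since the angle is
  monotone in both coefficients, a constraint that jumps over a leaf at least as large as one of its
  two ends is implied by a shorter one. Hence the circle can be cut open at a largest leaf \<open>p\<close>, and the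
  least solution \<open>T\<close> of the non-strict system starting with \<open>T p = 0\<close> is a longest-path computation in
  which only the positions on a monotone stack matter; every position is pushed and popped at most
  once. If \<open>D\<close> is the value obtained on returning to \<open>p\<close>, the star is realizable if and only if
  \<open>D < 2\<pi>\<close>, and then stretching all angles by \<open>2\<pi> / D\<close> makes every constraint strict.

  For the machine, a small structured language with a costed semantics is compiled to jumps. Both the
  input and the output occupy the cells that serve as registers, so the input is first moved above
  the base \<open>64 n\<close>, and the output is built there and moved down at the end.
\<close>

section \<open>Structured programs\<close>

datatype com =
    Basic instr
  | Seq com com (infixr ";;" 60)
  | Cond nat nat com com
  | While nat nat com

fun jump_free :: "instr \<Rightarrow> bool" where
  "jump_free (JLeq _ _ _) = False"
| "jump_free Halt = False"
| "jump_free _ = True"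

text \<open>The time is the exact number of steps of the compiled code. A true test is one jump into
  its branch, while the false branch also pays for the jump over the other one. A loop round pays
  for the test and the jump back, the exit for the failed test and the jump out.\<close>

inductive big_step :: "com \<Rightarrow> (nat \<Rightarrow> real) \<Rightarrow> nat \<Rightarrow> (nat \<Rightarrow> real) \<Rightarrow> bool" where
  Basic: "jump_free i \<Longrightarrow> step [i] (0, m) = Some (1, m') \<Longrightarrow> big_step (Basic i) m 1 m'"
| Seq: "big_step c1 m t1 m1 \<Longrightarrow> big_step c2 m1 t2 m2 \<Longrightarrow> big_step (c1 ;; c2) m (t1 + t2) m2"
| CondTrue: "m a \<le> m b \<Longrightarrow> big_step c1 m t m' \<Longrightarrow> big_step (Cond a b c1 c2) m (Suc t) m'"
| CondFalse: "\<not> m a \<le> m b \<Longrightarrow> big_step c2 m t m' \<Longrightarrow> big_step (Cond a b c1 c2) m (t + 2) m'"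
| WhileTrue: "m a \<le> m b \<Longrightarrow> big_step c m t m1 \<Longrightarrow> big_step (While a b c) m1 u m2
    \<Longrightarrow> big_step (While a b c) m (t + 2 + u) m2"
| WhileFalse: "\<not> m a \<le> m b \<Longrightarrow> big_step (While a b c) m 2 m"

text \<open>Jump targets are absolute, so \<open>p\<close> gives the address of the first
  instruction. \<open>JLeq 0 0 t\<close> serves as an unconditional jump, and the false branch comes
  first because a failed test falls through.\<close>

primrec compile :: "nat \<Rightarrow> com \<Rightarrow> instr list" where
  "compile p (Basic i) = [i]"
| "compile p (c1 ;; c2) = (let xs = compile p c1 in xs @ compile (p + length xs) c2)"
| "compile p (Cond a b c1 c2) =
    (let ys = compile (Suc p) c2; q = p + length ys + 2; xs = compile q c1
     in JLeq a b q # ys @ JLeq 0 0 (q + length xs) # xs)"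
| "compile p (While a b c) =
    (let xs = compile (p + 2) c
     in JLeq a b (p + 2) # JLeq 0 0 (p + length xs + 3) # xs @ [JLeq 0 0 p])"

lemma exec_add: "exec P j s = Some s' \<Longrightarrow> exec P k s' = r \<Longrightarrow> exec P (j + k) s = r"
  by (induction j arbitrary: s) (auto split: option.splits)

lemma exec_one: "exec P 1 s = step P s"
  by (simp split: option.splits)

lemma step_jump_free:
  assumes "jump_free i" "step [i] (0, m) = Some (1, m')" "p < length P" "P ! p = i"
  shows "step P (p, m) = Some (Suc p, m')"
  using assms by (cases i) (auto split: if_splits)

lemma step_JLeq:
  assumes "p < length P" "P ! p = JLeq a b t"
  shows "step P (p, m) = Some (if m a \<le> m b then t else Suc p, m)"
  using assms by simp

text \<open>The surrounding code \<open>us\<close> and \<open>vs\<close> is arbitrary because the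
  induction meets every subprogram in place inside a larger one; the length of \<open>us\<close>
  fixes its addresses.\<close>

lemma compile_correct:
  assumes "big_step c m t m'"
  shows "exec (us @ compile (length us) c @ vs) t (length us, m)
       = Some (length us + length (compile (length us) c), m')"
  using assms
proof (induction arbitrary: us vs rule: big_step.induct)
  case (Basic i m m')
  then show ?case
    unfolding exec_one by (subst step_jump_free) auto
next
  case (Seq c1 m t1 m1 c2 t2 m2)
  let ?xs = "compile (length us) c1"
  let ?ys = "compile (length us + length ?xs) c2"
  have 1: "exec (us @ ?xs @ ?ys @ vs) t1 (length us, m) = Some (length us + length ?xs, m1)"
    using Seq.IH(1)[of us "?ys @ vs"] by simp
  have 2: "exec (us @ ?xs @ ?ys @ vs) t2 (length us + length ?xs, m1)
      = Some (length us + length ?xs + length ?ys, m2)"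
    using Seq.IH(2)[of "us @ ?xs" vs] by simp
  show ?case using exec_add[OF 1 2] by (simp add: Let_def add.assoc)
next
  case (CondTrue m a b c1 t m' c2)
  define ys where "ys = compile (Suc (length us)) c2"
  define q where "q = length us + length ys + 2"
  define xs where "xs = compile q c1"
  define P where "P = us @ (JLeq a b q # ys @ JLeq 0 0 (q + length xs) # xs) @ vs"
  have 1: "exec P 1 (length us, m) = Some (q, m)"
    unfolding exec_one using CondTrue.hyps by (subst step_JLeq) (auto simp: P_def)
  have 2: "exec P t (q, m) = Some (q + length xs, m')"
    using CondTrue.IH[of "us @ JLeq a b q # ys @ [JLeq 0 0 (q + length xs)]" vs]
    by (simp add: P_def xs_def q_def)
  show ?case using exec_add[OF 1 2]
    by (simp add: Let_def P_def xs_def q_def ys_def)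
next
  case (CondFalse m a b c2 t m' c1)
  define ys where "ys = compile (Suc (length us)) c2"
  define q where "q = length us + length ys + 2"
  define xs where "xs = compile q c1"
  define P where "P = us @ (JLeq a b q # ys @ JLeq 0 0 (q + length xs) # xs) @ vs"
  have 1: "exec P 1 (length us, m) = Some (Suc (length us), m)"
    unfolding exec_one using CondFalse.hyps by (subst step_JLeq) (auto simp: P_def)
  have 2: "exec P t (Suc (length us), m) = Some (Suc (length us) + length ys, m')"
    using CondFalse.IH[of "us @ [JLeq a b q]" "JLeq 0 0 (q + length xs) # xs @ vs"]
    by (simp add: P_def ys_def)
  have 3: "exec P 1 (Suc (length us) + length ys, m') = Some (q + length xs, m')"
    unfolding exec_one by (subst step_JLeq[where a=0 and b=0]) (auto simp: P_def nth_append)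
  show ?case using exec_add[OF 1 exec_add[OF 2 3]]
    by (simp add: Let_def P_def xs_def q_def ys_def)
next
  case (WhileTrue m a b c t m1 u m2)
  define p where "p = length us"
  define xs where "xs = compile (p + 2) c"
  define P where "P = us @ (JLeq a b (p + 2) # JLeq 0 0 (p + length xs + 3) # xs @ [JLeq 0 0 p]) @ vs"
  have 1: "exec P 1 (p, m) = Some (p + 2, m)"
    unfolding exec_one using WhileTrue.hyps by (subst step_JLeq) (auto simp: P_def p_def)
  have 2: "exec P t (p + 2, m) = Some (p + 2 + length xs, m1)"
    using WhileTrue.IH(1)[of "us @ [JLeq a b (p + 2), JLeq 0 0 (p + length xs + 3)]" "JLeq 0 0 p # vs"]
    by (simp add: P_def p_def xs_def)
  have 3: "exec P 1 (p + 2 + length xs, m1) = Some (p, m1)"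
    unfolding exec_one by (subst step_JLeq[where a=0 and b=0]) (auto simp: P_def p_def nth_append)
  have 4: "exec P u (p, m1) = Some (p + length xs + 3, m2)"
    using WhileTrue.IH(2)[of us vs] by (simp add: P_def p_def xs_def Let_def add_ac)
  show ?case using exec_add[OF 1 exec_add[OF 2 exec_add[OF 3 4]]]
    by (simp add: Let_def P_def xs_def p_def add_ac)
next
  case (WhileFalse m a b c)
  define p where "p = length us"
  define xs where "xs = compile (p + 2) c"
  define P where "P = us @ (JLeq a b (p + 2) # JLeq 0 0 (p + length xs + 3) # xs @ [JLeq 0 0 p]) @ vs"
  have 1: "exec P 1 (p, m) = Some (Suc p, m)"
    unfolding exec_one using WhileFalse.hyps by (subst step_JLeq) (auto simp: P_def p_def)
  have 2: "exec P 1 (Suc p, m) = Some (p + length xs + 3, m)"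
    unfolding exec_one by (subst step_JLeq[where a=0 and b=0]) (auto simp: P_def p_def nth_append)
  show ?case using exec_add[OF 1 2]
    by (simp add: Let_def P_def xs_def p_def numeral_2_eq_2 add_ac)
qed

text \<open>Total correctness with a time limit. An upper bound instead of the exact count lets
  branches of different cost be combined.\<close>

definition terminates :: "com \<Rightarrow> nat \<Rightarrow> ((nat \<Rightarrow> real) \<Rightarrow> bool) \<Rightarrow> (nat \<Rightarrow> real) \<Rightarrow> bool" where
  "terminates c t Q m \<longleftrightarrow> (\<exists>t'\<le>t. \<exists>m'. big_step c m t' m' \<and> Q m')"

lemma terminates_mono:
  "terminates c t Q m \<Longrightarrow> t \<le> u \<Longrightarrow> (\<And>m'. Q m' \<Longrightarrow> R m') \<Longrightarrow> terminates c u R m"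
  unfolding terminates_def by (meson le_trans)

lemma terminates_Seq:
  "terminates c1 t1 R m \<Longrightarrow> (\<And>m'. R m' \<Longrightarrow> terminates c2 t2 Q m') \<Longrightarrow> terminates (c1 ;; c2) (t1 + t2) Q m"
  unfolding terminates_def by (meson add_mono big_step.Seq)

lemma terminates_Cond:
  assumes "m a \<le> m b \<Longrightarrow> terminates c1 t Q m" "\<not> m a \<le> m b \<Longrightarrow> terminates c2 t Q m"
  shows "terminates (Cond a b c1 c2) (t + 2) Q m"
proof (cases "m a \<le> m b")
  case True
  with assms obtain t' m' where "t' \<le> t" "big_step c1 m t' m'" "Q m'"
    by (auto simp: terminates_def)
  then show ?thesis unfolding terminates_def using big_step.CondTrue[of m a b c1 t' m' c2] True
    by (intro exI[of _ "Suc t'"]) auto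
next
  case False
  with assms obtain t' m' where "t' \<le> t" "big_step c2 m t' m'" "Q m'"
    by (auto simp: terminates_def)
  then show ?thesis unfolding terminates_def using big_step.CondFalse[of m a b c2 t' m' c1] False
    by (intro exI[of _ "t' + 2"]) auto
qed

text \<open>The ghost state \<open>s\<close> indexes the invariant and carries the measure that
  bounds the number of rounds. The measure need not be a counter in memory, which leaves room for
  amortized bounds.\<close>

lemma terminates_While:
  fixes f :: "'s \<Rightarrow> nat"
  assumes body: "\<And>s m. J s m \<Longrightarrow> m a \<le> m b \<Longrightarrow> terminates c t (\<lambda>m'. \<exists>s'. J s' m' \<and> f s' < f s) m"
    and "J s m"
    and exit: "\<And>s m. J s m \<Longrightarrow> \<not> m a \<le> m b \<Longrightarrow> Q m"
  shows "terminates (While a b c) ((t + 2) * f s + 2) Q m"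
  using \<open>J s m\<close>
proof (induction "f s" arbitrary: s m rule: less_induct)
  case less
  show ?case
  proof (cases "m a \<le> m b")
    case True
    from body[OF less.prems True] obtain t1 m1 s' where
      1: "t1 \<le> t" "big_step c m t1 m1" "f s' < f s" "J s' m1"
      unfolding terminates_def by blast
    from less.hyps[OF 1(3,4)] obtain u m2 where
      2: "u \<le> (t + 2) * f s' + 2" "big_step (While a b c) m1 u m2" "Q m2"
      by (auto simp: terminates_def)
    have "(t + 2) * Suc (f s') \<le> (t + 2) * f s" using 1(3) by (intro mult_le_mono) auto
    then have "t1 + 2 + u \<le> (t + 2) * f s + 2" using 1(1) 2(1) by simp
    then show ?thesis unfolding terminates_def using big_step.WhileTrue[OF True 1(2) 2(2)] 2(3) by blast
  next
    case False
    then show ?thesis unfolding terminates_def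
      using big_step.WhileFalse[OF False, of c] exit[OF less.prems False] by (intro exI[of _ 2]) auto
  qed
qed

section \<open>Addresses and weakest preconditions of loop-free code\<close>

definition cell :: "real \<Rightarrow> nat" where
  "cell x = nat \<lfloor>x\<rfloor>"

lemma cell_simps [simp]:
  "cell (real x) = x"
  "cell (real x + real y) = x + y"
  "cell (real x + real y + real z) = x + y + z"
  "cell (real x + (real y + real z)) = x + (y + z)"
  "cell (real x + 1) = x + 1"
  "cell (real x + (real y + 1)) = x + y + 1"
  "cell (real x + real y + 1) = x + y + 1"
  "cell (real x + numeral k) = x + numeral k"
  "cell (1 + real x) = 1 + x"
  "cell (numeral k + real x) = numeral k + x"
  unfolding cell_def
  by (metis of_nat_1 of_nat_add of_nat_numeral floor_of_nat nat_int add.assoc)+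

lemma Nats_sum_simps [simp]:
  "real x + real y \<in> \<nat>"
  "real x + real y + real z \<in> \<nat>"
  "real x + (real y + real z) \<in> \<nat>"
  "real x + 1 \<in> \<nat>"
  "real x + (real y + 1) \<in> \<nat>"
  "real x + real y + 1 \<in> \<nat>"
  "real x + numeral k \<in> \<nat>"
  "1 + real x \<in> \<nat>"
  "numeral k + real x \<in> \<nat>"
  by (intro Nats_add of_nat_in_Nats Nats_1 Nats_numeral)+

fun wp_instr :: "instr \<Rightarrow> ((nat \<Rightarrow> real) \<Rightarrow> bool) \<Rightarrow> (nat \<Rightarrow> real) \<Rightarrow> bool" where
  "wp_instr (Const d c) Q m = Q (m(d := of_int c))"
| "wp_instr (Copy d a) Q m = Q (m(d := m a))"
| "wp_instr (Add d a b) Q m = Q (m(d := m a + m b))"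
| "wp_instr (Sub d a b) Q m = Q (m(d := m a - m b))"
| "wp_instr (Mul d a b) Q m = Q (m(d := m a * m b))"
| "wp_instr (Div d a b) Q m = (m b \<noteq> 0 \<and> Q (m(d := m a / m b)))"
| "wp_instr (Sqrt d a) Q m = (0 \<le> m a \<and> Q (m(d := sqrt (m a))))"
| "wp_instr (Sin d a) Q m = Q (m(d := sin (m a)))"
| "wp_instr (Cos d a) Q m = Q (m(d := cos (m a)))"
| "wp_instr (Arctan d a) Q m = Q (m(d := arctan (m a)))"
| "wp_instr (Arcsin d a) Q m = (\<bar>m a\<bar> \<le> 1 \<and> Q (m(d := arcsin (m a))))"
| "wp_instr (Load d a) Q m = (m a \<in> \<nat> \<and> Q (m(d := m (cell (m a)))))"
| "wp_instr (Store a s) Q m = (m a \<in> \<nat> \<and> Q (m(cell (m a) := m s)))"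
| "wp_instr _ Q m = False"

text \<open>Loops get \<open>False\<close>, since they are treated by
  \<open>terminates_While\<close> with an invariant.\<close>

primrec wp :: "com \<Rightarrow> ((nat \<Rightarrow> real) \<Rightarrow> bool) \<Rightarrow> (nat \<Rightarrow> real) \<Rightarrow> bool" where
  "wp (Basic i) Q m = wp_instr i Q m"
| "wp (c1 ;; c2) Q m = wp c1 (wp c2 Q) m"
| "wp (Cond a b c1 c2) Q m = (if m a \<le> m b then wp c1 Q m else wp c2 Q m)"
| "wp (While a b c) Q m = False"

text \<open>Adding the costs of both branches gives an upper bound without a case split. The value
  for loops is a default; \<open>wp\<close> fails on them.\<close>

primrec cost :: "com \<Rightarrow> nat" where
  "cost (Basic i) = 1"
| "cost (c1 ;; c2) = cost c1 + cost c2"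
| "cost (Cond a b c1 c2) = cost c1 + cost c2 + 2"
| "cost (While a b c) = 0"

lemma wp_instr_step:
  "wp_instr i Q m \<Longrightarrow> jump_free i \<and> (\<exists>m'. step [i] (0, m) = Some (1, m') \<and> Q m')"
  by (cases i) (auto simp: cell_def)

lemma terminates_loop_free: "wp c Q m \<Longrightarrow> terminates c (cost c) Q m"
proof (induction c arbitrary: Q m)
  case (Basic i)
  then show ?case using wp_instr_step[of i Q m] big_step.Basic
    by (force simp: terminates_def)
next
  case (Seq c1 c2)
  then have "terminates c1 (cost c1) (wp c2 Q) m" by simp
  from terminates_Seq[OF this Seq.IH(2)] show ?case by simp
next
  case (Cond a b c1 c2)
  then have "terminates (Cond a b c1 c2) (cost c1 + cost c2 + 2) Q m"
    by (intro terminates_Cond) (auto intro: terminates_mono[OF Cond.IH(1)] terminates_mono[OF Cond.IH(2)])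
  then show ?case by simp
qed auto

fun block :: "instr list \<Rightarrow> com" where
  "block [] = Basic (Copy 0 0)"
| "block [i] = Basic i"
| "block (i # is) = Basic i ;; block is"

section \<open>Geometry of stars\<close>

definition touch_angle :: "real \<Rightarrow> real \<Rightarrow> real" where
  "touch_angle a b = 2 * arcsin (a * b)"

text \<open>In the triangle with sides \<open>w 0 + w i\<close>, \<open>w 0 + w j\<close> and
  \<open>w i + w j\<close>, the half-angle formula gives
  \<open>w i * w j / ((w 0 + w i) * (w 0 + w j))\<close> for the squared sine of half the angle at
  the centre. This factors into one coefficient per leaf.\<close>

definition leaf_coeff :: "(nat \<Rightarrow> real) \<Rightarrow> nat \<Rightarrow> real" where
  "leaf_coeff w i = sqrt (w i / (w 0 + w i))"

lemma leaf_coeff_bounds: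
  assumes "0 < w 0" "0 < w i"
  shows "0 < leaf_coeff w i" "leaf_coeff w i < 1"
  using assms by (auto simp: leaf_coeff_def)

lemma touch_angle_commute: "touch_angle a b = touch_angle b a"
  by (simp add: touch_angle_def mult.commute)

lemma mult_bounds:
  fixes a b :: real
  assumes "0 < a" "a < 1" "0 < b" "b < 1"
  shows "0 < a * b" "a * b < 1"
  using assms mult_strict_mono[of a 1 b 1] by auto

lemma touch_angle_bounds:
  assumes "0 < a" "a < 1" "0 < b" "b < 1"
  shows "0 < touch_angle a b" "touch_angle a b < pi"
proof -
  note ab = mult_bounds[OF assms]
  show "0 < touch_angle a b"
    using arcsin_less_arcsin[of 0 "a * b"] ab by (simp add: touch_angle_def)
  show "touch_angle a b < pi"
    using arcsin_less_arcsin[of "a * b" 1] ab by (simp add: touch_angle_def)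
qed

lemma touch_angle_mono:
  assumes "0 < a" "a < 1" "0 < b" "b \<le> c" "c < 1"
  shows "touch_angle a b \<le> touch_angle a c"
proof -
  have "0 < a * b" "a * b \<le> a * c" "a * c \<le> 1"
    using assms mult_bounds[of a b] mult_bounds[of a c] by auto
  then show ?thesis by (auto simp: touch_angle_def intro!: arcsin_le_arcsin)
qed

text \<open>Sine increases while \<open>\<delta> / 2\<close> is at most \<open>pi / 2\<close>, and
  the remaining range is reflected to \<open>pi - \<delta> / 2\<close>. In each case one of the two
  inequalities on the right is automatic.\<close>

lemma sin_half_gt_iff:
  assumes "0 \<le> x" "x < 1" "0 \<le> \<delta>" "\<delta> \<le> 2 * pi"
  shows "x < sin (\<delta> / 2) \<longleftrightarrow> 2 * arcsin x < \<delta> \<and> \<delta> < 2 * pi - 2 * arcsin x"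
proof -
  have x: "0 \<le> arcsin x" "arcsin x < pi / 2" "sin (arcsin x) = x"
    using assms arcsin_less_arcsin[of x 1] arcsin_nonneg[of x] by auto
  show ?thesis
  proof (cases "\<delta> \<le> pi")
    case True
    have "x < sin (\<delta> / 2) \<longleftrightarrow> arcsin x < \<delta> / 2"
      using sin_mono_less_eq[of "arcsin x" "\<delta> / 2"] x assms True by auto
    then show ?thesis using x True by auto
  next
    case False
    have "x < sin (pi - \<delta> / 2) \<longleftrightarrow> arcsin x < pi - \<delta> / 2"
      using sin_mono_less_eq[of "arcsin x" "pi - \<delta> / 2"] x assms False by auto
    then show ?thesis using x False by auto
  qed
qed

text \<open>The law of cosines, with the cosine replaced by the sine of the half angle, the form in
  which the coefficients appear.\<close>

lemma dist_polar_squared: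
  "(dist (z + of_real u * cis s) (z + of_real v * cis t))\<^sup>2 = (u - v)\<^sup>2 + 4 * u * v * (sin ((t - s) / 2))\<^sup>2"
proof -
  have "(dist (z + of_real u * cis s) (z + of_real v * cis t))\<^sup>2
      = (u * cos s - v * cos t)\<^sup>2 + (u * sin s - v * sin t)\<^sup>2"
    by (simp add: dist_norm cmod_power2)
  also have "\<dots> = u\<^sup>2 * ((cos s)\<^sup>2 + (sin s)\<^sup>2) + v\<^sup>2 * ((cos t)\<^sup>2 + (sin t)\<^sup>2) - 2 * u * v * cos (t - s)"
    unfolding cos_diff
    by (simp add: power2_eq_square algebra_simps
        del: sin_cos_squared_add sin_cos_squared_add2 sin_cos_squared_add3)
  also have "\<dots> = u\<^sup>2 + v\<^sup>2 - 2 * u * v * cos (t - s)"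
    by simp
  also have "cos (t - s) = 1 - 2 * (sin ((t - s) / 2))\<^sup>2"
    using cos_double_sin[of "(t - s) / 2"] by (simp only: mult_2 field_sum_of_halves)
  finally show ?thesis by (simp add: power2_eq_square algebra_simps)
qed

text \<open>After squaring, both sides contain the same multiple of \<open>(w i - w j)^2\<close>;
  what remains is a common positive factor times the squares of \<open>?a\<close> and
  \<open>?S\<close>. Hence the scale \<open>k\<close> cancels.\<close>

lemma leaves_apart_iff:
  assumes pos: "0 < w 0" "0 < w i" "0 < w j" and k: "0 < k" and d: "0 \<le> t - s" "t - s \<le> 2 * pi"
  shows "k * w i + k * w j < dist (z + of_real (k * w 0 + k * w i) * cis s) (z + of_real (k * w 0 + k * w j) * cis t)
    \<longleftrightarrow> touch_angle (leaf_coeff w i) (leaf_coeff w j) < t - s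
      \<and> t - s < 2 * pi - touch_angle (leaf_coeff w i) (leaf_coeff w j)"
    (is "_ < ?D \<longleftrightarrow> _")
proof -
  let ?u = "w 0 + w i" and ?v = "w 0 + w j" and ?a = "leaf_coeff w i * leaf_coeff w j"
  let ?S = "sin ((t - s) / 2)"
  note a = mult_bounds[OF leaf_coeff_bounds[of w i] leaf_coeff_bounds[of w j]]
  have S: "0 \<le> ?S" using d by (intro sin_ge_zero) auto
  have a2: "?u * ?v * ?a\<^sup>2 = w i * w j"
    using pos by (simp add: leaf_coeff_def power_mult_distrib)
  have "?D\<^sup>2 = k\<^sup>2 * ((w i - w j)\<^sup>2 + 4 * (?u * ?v * ?S\<^sup>2))"
    unfolding dist_polar_squared by (simp add: power2_eq_square algebra_simps)
  moreover have "(k * w i + k * w j)\<^sup>2 = k\<^sup>2 * ((w i - w j)\<^sup>2 + 4 * (?u * ?v * ?a\<^sup>2))"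
    unfolding a2 by (simp add: power2_eq_square algebra_simps)
  ultimately have "(k * w i + k * w j)\<^sup>2 < ?D\<^sup>2 \<longleftrightarrow> ?u * ?v * ?a\<^sup>2 < ?u * ?v * ?S\<^sup>2"
    using k by simp
  also have "\<dots> \<longleftrightarrow> ?a\<^sup>2 < ?S\<^sup>2"
    using pos by (intro mult_less_cancel_left_pos) auto
  also have "\<dots> \<longleftrightarrow> ?a < ?S"
    using S a pos power_mono_iff[of ?S ?a 2] by (simp flip: not_le)
  finally have "(k * w i + k * w j)\<^sup>2 < ?D\<^sup>2 \<longleftrightarrow> ?a < ?S" .
  moreover have "k * w i + k * w j < ?D \<longleftrightarrow> (k * w i + k * w j)\<^sup>2 < ?D\<^sup>2"
    using pos k power_mono_iff[of ?D "k * w i + k * w j" 2] by (simp flip: not_le)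
  ultimately show ?thesis
    using sin_half_gt_iff[of ?a "t - s"] a d pos by (simp add: touch_angle_def)
qed

text \<open>If the centres are at distance at most \<open>r + s\<close>, a common point is
  \<open>y\<close> itself or the point of the segment from \<open>x\<close> to \<open>y\<close> at
  distance \<open>r\<close> from \<open>x\<close>.\<close>

lemma cball_disjoint_iff:
  fixes x y :: "'a::real_normed_vector"
  assumes "0 \<le> r" "0 \<le> s"
  shows "cball x r \<inter> cball y s = {} \<longleftrightarrow> r + s < dist x y"
proof
  assume disj: "cball x r \<inter> cball y s = {}"
  show "r + s < dist x y"
  proof (rule ccontr)
    assume "\<not> r + s < dist x y"
    then have le: "dist x y \<le> r + s" by simp
    show False
    proof (cases "dist x y \<le> r")
      case True
      then have "y \<in> cball x r \<inter> cball y s" using assms by simp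
      then show False using disj by blast
    next
      case False
      define q where "q = x + (r / dist x y) *\<^sub>R (y - x)"
      have d: "0 < dist x y" using False assms by linarith
      have "dist x q = r"
        using d assms by (simp add: q_def dist_norm norm_minus_commute)
      have "y - q = (1 - r / dist x y) *\<^sub>R (y - x)" by (simp add: q_def algebra_simps)
      then have "dist y q = \<bar>1 - r / dist x y\<bar> * dist x y"
        by (simp add: dist_norm norm_minus_commute)
      also have "\<dots> = dist x y - r" using d False by (simp add: field_simps)
      finally have "q \<in> cball x r \<inter> cball y s" using \<open>dist x q = r\<close> le by simp
      then show False using disj by blast
    qed
  qed
qed (rule disjoint_cballI)

text \<open>The upper bound is the same constraint measured the other way round the circle.\<close>

definition separated_angles :: "nat \<Rightarrow> (nat \<Rightarrow> real) \<Rightarrow> (nat \<Rightarrow> real) \<Rightarrow> bool" where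
  "separated_angles n a \<theta> \<longleftrightarrow> (\<forall>i j. 1 \<le> i \<and> i < j \<and> j \<le> n \<longrightarrow>
     touch_angle (a i) (a j) < \<theta> j - \<theta> i \<and> \<theta> j - \<theta> i < 2 * pi - touch_angle (a i) (a j))"

text \<open>The scale is 1 and the centre is the origin. Only the values of \<open>c\<close> and
  \<open>r\<close> at the vertices \<open>0\<close> to \<open>n\<close> are prescribed, so both can
  be read off the final memory of the machine.\<close>

lemma star_rep_of_separated_angles:
  assumes pos: "\<forall>i\<le>n. 0 < w i" and sep: "separated_angles n (leaf_coeff w) \<theta>"
    and c0: "c 0 = 0" and c: "\<And>i. 1 \<le> i \<Longrightarrow> i \<le> n \<Longrightarrow> c i = of_real (w 0 + w i) * cis (\<theta> i)"
    and r: "\<And>i. i \<le> n \<Longrightarrow> r i = w i"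
  shows "star_wdcr n w c r" "respects_embedding n c r"
proof -
  have ang: "0 < touch_angle (leaf_coeff w i) (leaf_coeff w j)" if "i \<le> n" "j \<le> n" for i j
    using touch_angle_bounds(1) leaf_coeff_bounds pos that by simp
  have lt: "\<theta> i < \<theta> j" "\<theta> j - \<theta> i < 2 * pi" if "1 \<le> i" "i < j" "j \<le> n" for i j
    using sep ang[of i j] that unfolding separated_angles_def by (smt (verit) less_imp_le_nat le_trans)+
  have apart: "r i + r j < dist (c i) (c j)" if ij: "1 \<le> i" "i < j" "j \<le> n" for i j
    using leaves_apart_iff[of w i j 1 "\<theta> j" "\<theta> i" 0] sep ij pos lt[OF ij] c[of i] c[of j] r[of i] r[of j]
    unfolding separated_angles_def by auto
  then have apart': "r i + r j < dist (c i) (c j)" if "1 \<le> i" "1 \<le> j" "i \<noteq> j" "i \<le> n" "j \<le> n" for i j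
    using that by (metis add.commute dist_commute linorder_neqE_nat)
  have centre: "dist (c 0) (c i) = r 0 + r i" if "1 \<le> i" "i \<le> n" for i
    using that pos[rule_format, of 0] pos[rule_format, of i] c[OF that] r[of 0] r[of i] c0
    by (simp add: norm_mult del: of_real_add)
  have dist_ge: "r i + r j \<le> dist (c i) (c j) \<and> (dist (c i) (c j) = r i + r j \<longleftrightarrow> i = 0 \<or> j = 0)"
    if "i \<le> n" "j \<le> n" "i \<noteq> j" for i j
    using that apart'[of i j] centre[of i] centre[of j]
    by (cases "i = 0"; cases "j = 0") (auto simp: dist_commute)
  have rpos: "0 \<le> r i" if "i \<le> n" for i using r pos that by (simp add: less_imp_le)
  show "star_wdcr n w c r"
    unfolding star_wdcr_def
  proof (intro conjI allI impI)
    show "\<exists>s>0. \<forall>i\<le>n. r i = s * w i" using r by (intro exI[of _ 1]) auto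
  next
    fix i j assume "i \<le> n" "j \<le> n" "i \<noteq> j"
    then show "ball (c i) (r i) \<inter> ball (c j) (r j) = {}"
      using dist_ge by (intro disjoint_ballI) auto
  next
    fix i j assume "i \<le> n" "j \<le> n" "i \<noteq> j"
    then show "cball (c i) (r i) \<inter> cball (c j) (r j) \<noteq> {} \<longleftrightarrow> i = 0 \<or> j = 0"
      using dist_ge[of i j] by (simp add: cball_disjoint_iff rpos) linarith
  qed
  show "respects_embedding n c r"
    unfolding respects_embedding_def
  proof (intro exI[of _ \<theta>] conjI allI impI)
    fix i assume "1 \<le> i \<and> i < n"
    then show "\<theta> i < \<theta> (Suc i)" using lt by simp
  next
    assume "1 \<le> n"
    then show "\<theta> n < \<theta> 1 + 2 * pi" using lt(2)[of 1 n] pi_gt_zero by (cases "n = 1") auto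
  next
    fix i assume "1 \<le> i \<and> i \<le> n"
    then show "c i = c 0 + of_real (r 0 + r i) * cis (\<theta> i)" using c c0 r by simp
  qed
qed

text \<open>The angles of the embedding serve unchanged: they increase within one turn, so all
  differences lie in the range where \<open>leaves_apart_iff\<close> applies.\<close>

lemma separated_angles_of_star_rep:
  assumes pos: "\<forall>i\<le>n. 0 < w i" and rep: "star_wdcr n w c r" "respects_embedding n c r"
  obtains \<theta> where "separated_angles n (leaf_coeff w) \<theta>"
proof -
  from rep(1) obtain k where k: "0 < k" "\<And>i. i \<le> n \<Longrightarrow> r i = k * w i"
    unfolding star_wdcr_def by blast
  from rep(2) obtain \<theta> where \<theta>: "\<And>i. 1 \<le> i \<Longrightarrow> i < n \<Longrightarrow> \<theta> i < \<theta> (Suc i)" "1 \<le> n \<longrightarrow> \<theta> n < \<theta> 1 + 2 * pi"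
    "\<And>i. 1 \<le> i \<Longrightarrow> i \<le> n \<Longrightarrow> c i = c 0 + of_real (r 0 + r i) * cis (\<theta> i)"
    unfolding respects_embedding_def by blast
  have mono: "\<theta> i \<le> \<theta> j" if "1 \<le> i" "i \<le> j" "j \<le> n" for i j
    using that(2,3)
  proof (induction j rule: dec_induct)
    case (step m)
    then show ?case using \<theta>(1)[of m] that(1) by simp
  qed simp
  have "separated_angles n (leaf_coeff w) \<theta>"
    unfolding separated_angles_def
  proof (intro allI impI)
    fix i j assume ij: "1 \<le> i \<and> i < j \<and> j \<le> n"
    have "0 \<le> \<theta> j - \<theta> i" "\<theta> j - \<theta> i \<le> 2 * pi"
      using mono[of i j] mono[of 1 i] mono[of j n] \<theta>(2) ij by auto
    moreover have "cball (c i) (r i) \<inter> cball (c j) (r j) = {}"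
      using rep(1) ij unfolding star_wdcr_def by (metis le_trans less_imp_le_nat not_one_le_zero nat_neq_iff)
    then have "r i + r j < dist (c i) (c j)"
      using pos k ij by (subst (asm) cball_disjoint_iff) (auto simp: less_imp_le)
    ultimately show "touch_angle (leaf_coeff w i) (leaf_coeff w j) < \<theta> j - \<theta> i \<and>
        \<theta> j - \<theta> i < 2 * pi - touch_angle (leaf_coeff w i) (leaf_coeff w j)"
      using leaves_apart_iff[of w i j k "\<theta> j" "\<theta> i" "c 0"] ij pos k \<theta>(3) by simp
  qed
  then show ?thesis by (rule that)
qed

section \<open>Scanning the leaves with a stack\<close>

text \<open>Unrolls the circle over two turns, so that a round trip from leaf \<open>p\<close>
  becomes the interval from \<open>p\<close> to \<open>p + n\<close>, whose end is \<open>p\<close>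
  again.\<close>

definition cyclic_ext :: "nat \<Rightarrow> (nat \<Rightarrow> 'a) \<Rightarrow> nat \<Rightarrow> 'a" where
  "cyclic_ext n a x = (if x \<le> n then a x else a (x - n))"

text \<open>Longest-path lengths from \<open>p\<close> for the positions below \<open>j\<close>: the
  inequalities make \<open>T\<close> feasible, and the tight predecessor of every later position
  makes it least.\<close>

definition greedy_angles :: "nat \<Rightarrow> (nat \<Rightarrow> real) \<Rightarrow> nat \<Rightarrow> nat \<Rightarrow> (nat \<Rightarrow> real) \<Rightarrow> bool" where
  "greedy_angles n a p j T \<longleftrightarrow> T p = 0 \<and>
     (\<forall>x y. p \<le> x \<and> x < y \<and> y < j \<longrightarrow>
        T x + touch_angle (cyclic_ext n a x) (cyclic_ext n a y) \<le> T y) \<and>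
     (\<forall>y. p < y \<and> y < j \<longrightarrow>
        (\<exists>x. p \<le> x \<and> x < y \<and> T y = T x + touch_angle (cyclic_ext n a x) (cyclic_ext n a y)))"

locale leaf_cycle =
  fixes n :: nat and a :: "nat \<Rightarrow> real" and p :: nat
  assumes p: "1 \<le> p" "p \<le> n"
    and a_bounds: "\<And>i. 1 \<le> i \<Longrightarrow> i \<le> n \<Longrightarrow> 0 < a i \<and> a i < 1"
    and p_max: "\<And>i. 1 \<le> i \<Longrightarrow> i \<le> n \<Longrightarrow> a i \<le> a p"
begin

abbreviation b :: "nat \<Rightarrow> real" where "b \<equiv> cyclic_ext n a"

lemma b_bounds: "1 \<le> x \<Longrightarrow> x \<le> 2 * n \<Longrightarrow> 0 < b x \<and> b x < 1"
  using a_bounds[of x] a_bounds[of "x - n"] by (auto simp: cyclic_ext_def)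

lemma b_le: "1 \<le> x \<Longrightarrow> x \<le> 2 * n \<Longrightarrow> b x \<le> b p"
  using p p_max[of x] p_max[of "x - n"] by (auto simp: cyclic_ext_def)

lemma b_end: "b (p + n) = b p"
  using p by (auto simp: cyclic_ext_def)

lemma angle_bounds:
  assumes "1 \<le> x" "x \<le> 2 * n" "1 \<le> y" "y \<le> 2 * n"
  shows "0 < touch_angle (b x) (b y)" "touch_angle (b x) (b y) < pi"
  using assms b_bounds touch_angle_bounds by auto

lemma angle_mono_right:
  assumes "1 \<le> x" "x \<le> 2 * n" "1 \<le> y" "y \<le> 2 * n" "1 \<le> z" "z \<le> 2 * n" "b y \<le> b z"
  shows "touch_angle (b x) (b y) \<le> touch_angle (b x) (b z)"
  using assms b_bounds touch_angle_mono by auto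

lemma angle_mono_left:
  assumes "1 \<le> x" "x \<le> 2 * n" "1 \<le> y" "y \<le> 2 * n" "1 \<le> z" "z \<le> 2 * n" "b y \<le> b z"
  shows "touch_angle (b y) (b x) \<le> touch_angle (b z) (b x)"
  using angle_mono_right[OF assms] by (simp add: touch_angle_commute)

section \<open>Realizability and the length of a full turn\<close>

context
  fixes T :: "nat \<Rightarrow> real"
  assumes T: "greedy_angles n a p (p + n + 1) T"
begin

lemma greedy_start: "T p = 0"
  and greedy_step: "p \<le> x \<Longrightarrow> x < y \<Longrightarrow> y \<le> p + n \<Longrightarrow> T x + touch_angle (b x) (b y) \<le> T y"
  and greedy_tight: "p < y \<Longrightarrow> y \<le> p + n \<Longrightarrow> \<exists>x. p \<le> x \<and> x < y \<and> T y = T x + touch_angle (b x) (b y)"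
  using T unfolding greedy_angles_def by (simp_all add: less_Suc_eq_le)

lemma greedy_nonneg: "p \<le> x \<Longrightarrow> x \<le> p + n \<Longrightarrow> 0 \<le> T x"
  using greedy_step[of p x] greedy_start angle_bounds(1)[of p x] p by (cases "x = p") auto

lemma greedy_end_pos: "0 < T (p + n)"
  using greedy_step[of p "p + n"] greedy_start angle_bounds(1)[of p "p + n"] p by auto

text \<open>The greedy angles are the longest paths of the difference constraints, so every
  feasible configuration, unrolled from leaf \<open>p\<close>, dominates them.\<close>

lemma greedy_end_less:
  assumes "separated_angles n a \<theta>"
  shows "T (p + n) < 2 * pi"
proof -
  \<comment> \<open>The directions continued past leaf \<open>n\<close>, one turn later.\<close>
  define \<psi> where "\<psi> x = (if x \<le> n then \<theta> x else \<theta> (x - n) + 2 * pi)" for x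
  have sep: "touch_angle (a i) (a j) < \<theta> j - \<theta> i" "\<theta> j - \<theta> i < 2 * pi - touch_angle (a i) (a j)"
    if "1 \<le> i" "i < j" "j \<le> n" for i j
    using assms that unfolding separated_angles_def by auto
  have gap: "touch_angle (b x) (b y) < \<psi> y - \<psi> x" if xy: "p \<le> x" "x < y" "y \<le> p + n" for x y
  proof (cases "y = x + n")
    case True
    \<comment> \<open>Both positions are leaf \<open>p\<close>, a pair outside
      \<open>separated_angles\<close>; its gap is a full turn and the angle is below
      \<open>pi\<close>.\<close>
    then have "x = p" using xy by simp
    then show ?thesis
      using True p angle_bounds(2)[of p "p + n"] pi_ge_zero by (simp add: \<psi>_def del: pi_ge_zero)
  next
    case False
    consider "y \<le> n" | "x \<le> n" "n < y" "y - n < x" | "n < x"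
      using xy False by linarith
    then show ?thesis
    proof cases
      case 1
      then show ?thesis using sep(1)[of x y] xy p by (simp add: \<psi>_def cyclic_ext_def)
    next
      case 2
      \<comment> \<open>Only \<open>y\<close> has wrapped around, so the upper bound for the leaves
        \<open>y - n < x\<close> applies.\<close>
      then have "1 \<le> y - n" by simp
      then show ?thesis using 2 sep(2)[of "y - n" x] xy p touch_angle_commute[of "a x"]
        by (simp add: \<psi>_def cyclic_ext_def)
    next
      case 3
      then show ?thesis using sep(1)[of "x - n" "y - n"] xy p by (simp add: \<psi>_def cyclic_ext_def)
    qed
  qed
  have le: "T x \<le> \<psi> x - \<psi> p" if "p \<le> x" "x \<le> p + n" for x
    using that
  proof (induction x rule: less_induct)
    case (less x)
    show ?case
    proof (cases "x = p")
      case True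
      then show ?thesis by (simp add: greedy_start)
    next
      case False
      then obtain y where y: "p \<le> y" "y < x" "T x = T y + touch_angle (b y) (b x)"
        using greedy_tight[of x] less.prems by auto
      then show ?thesis using less.IH[of y] gap[of y x] less.prems by simp
    qed
  qed
  \<comment> \<open>Strictness comes from the last edge alone: \<open>le\<close> is a weak estimate,
    \<open>gap\<close> a strict one.\<close>
  obtain y where y: "p \<le> y" "y < p + n" "T (p + n) = T y + touch_angle (b y) (b (p + n))"
    using greedy_tight[of "p + n"] p by auto
  then have "T (p + n) < \<psi> (p + n) - \<psi> p" using le[of y] gap[of y "p + n"] by simp
  then show ?thesis using p by (auto simp: \<psi>_def)
qed

text \<open>The stretch factor exceeds 1, so weak constraints with positive angles become strict.
  The constraint around the other side follows from the one between \<open>y\<close> and the closing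
  copy of \<open>p\<close>, because \<open>p\<close> has the largest coefficient.\<close>

lemma scaled_greedy_gap:
  assumes lt: "T (p + n) < 2 * pi" and xy: "p \<le> x" "x < y" "y < p + n"
  defines "l \<equiv> 2 * pi / T (p + n)"
  shows "touch_angle (b x) (b y) < l * T y - l * T x"
    "l * T y - l * T x < 2 * pi - touch_angle (b x) (b y)"
proof -
  have l: "1 < l" using lt greedy_end_pos by (simp add: l_def)
  have lD: "l * T (p + n) = 2 * pi" using greedy_end_pos by (simp add: l_def)
  have stretch: "touch_angle (b u) (b v) < l * (T v - T u)" if "p \<le> u" "u < v" "v \<le> p + n" for u v
  proof -
    have "touch_angle (b u) (b v) < l * touch_angle (b u) (b v)"
      using l angle_bounds(1)[of u v] that p by auto
    also have "\<dots> \<le> l * (T v - T u)"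
      using l greedy_step[OF that] by (intro mult_left_mono) auto
    finally show ?thesis .
  qed
  show "touch_angle (b x) (b y) < l * T y - l * T x"
    using stretch[of x y] xy by (simp add: right_diff_distrib)
  have "touch_angle (b y) (b x) \<le> touch_angle (b y) (b p)"
    using xy p by (intro angle_mono_right b_le) auto
  also have "\<dots> < l * (T (p + n) - T y)"
    using stretch[of y "p + n"] xy by (simp add: b_end)
  also have "\<dots> = 2 * pi - l * T y" by (simp add: right_diff_distrib lD)
  finally have "touch_angle (b x) (b y) < 2 * pi - l * T y" by (simp add: touch_angle_commute)
  moreover have "0 \<le> l * T x" using l greedy_nonneg[of x] xy by simp
  ultimately show "l * T y - l * T x < 2 * pi - touch_angle (b x) (b y)" by linarith
qed

text \<open>Leaves before \<open>p\<close> are met as positions \<open>i + n\<close> and are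
  therefore turned back by \<open>2 * pi\<close>.\<close>

lemma separated_scaled_greedy:
  assumes lt: "T (p + n) < 2 * pi"
  defines "l \<equiv> 2 * pi / T (p + n)"
  shows "separated_angles n a (\<lambda>i. if p \<le> i then l * T i else l * T (i + n) - 2 * pi)"
  unfolding separated_angles_def
proof (intro allI impI)
  fix i j assume ij: "1 \<le> i \<and> i < j \<and> j \<le> n"
  have ext: "b i = a i" "b (i + n) = a i" "b j = a j" "b (j + n) = a j"
    using ij by (auto simp: cyclic_ext_def)
  note gap = scaled_greedy_gap[OF lt, folded l_def]
  consider "p \<le> i" | "j < p" | "i < p" "p \<le> j" by linarith
  then show "touch_angle (a i) (a j)
      < (if p \<le> j then l * T j else l * T (j + n) - 2 * pi) - (if p \<le> i then l * T i else l * T (i + n) - 2 * pi) \<and>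
    (if p \<le> j then l * T j else l * T (j + n) - 2 * pi) - (if p \<le> i then l * T i else l * T (i + n) - 2 * pi)
      < 2 * pi - touch_angle (a i) (a j)"
  proof cases
    case 1
    then show ?thesis using gap[of i j] ij p by (simp add: ext)
  next
    case 2
    then show ?thesis using gap[of "i + n" "j + n"] ij p by (simp add: ext)
  next
    case 3
    \<comment> \<open>Position \<open>j\<close> precedes \<open>i + n\<close>, so the two
      inequalities exchange their roles.\<close>
    then show ?thesis using gap[of j "i + n"] ij p by (simp add: ext touch_angle_commute)
  qed
qed

end

text \<open>State of the scan while the angle of position \<open>j\<close> is computed. The stack
  \<open>S 0, \<dots>, S sp\<close> holds positions with non-increasing coefficients, and \<open>cur\<close> is the best
  lower bound found so far. A position \<open>i\<close> that is not on the stack is irrelevant because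
  some stacked position after it is at least as large, or, for the current \<open>j\<close>, because
  it has already been accounted for in \<open>cur\<close> and will be dominated by \<open>j\<close>.\<close>

definition scan_inv :: "nat \<Rightarrow> real \<Rightarrow> nat \<Rightarrow> (nat \<Rightarrow> nat) \<Rightarrow> (nat \<Rightarrow> real) \<Rightarrow> bool" where
  "scan_inv j cur sp S T \<longleftrightarrow>
     p < j \<and> j \<le> p + n + 1 \<and> greedy_angles n a p j T \<and> S 0 = p \<and>
     (\<forall>k\<le>sp. p \<le> S k \<and> S k < j) \<and>
     (\<forall>k<sp. S k < S (Suc k) \<and> b (S (Suc k)) \<le> b (S k)) \<and>
     (cur = 0 \<or> (\<exists>i. p \<le> i \<and> i < j \<and> cur = T i + touch_angle (b i) (b j))) \<and>
     (\<forall>i. p \<le> i \<and> i < j \<longrightarrow>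
        (b i \<le> b j \<and> T i + touch_angle (b i) (b j) \<le> cur) \<or>
        (\<exists>k\<le>sp. i \<le> S k \<and> b i \<le> b (S k)))"

section \<open>Preservation of the stack invariant\<close>

lemma scan_inv_init: "T p = 0 \<Longrightarrow> S 0 = p \<Longrightarrow> scan_inv (p + 1) 0 0 S T"
  using p by (auto simp: scan_inv_def greedy_angles_def le_less_Suc_eq)

text \<open>Stacked positions increase strictly from \<open>p\<close>, hence \<open>S k\<close> is
  at least \<open>p + k\<close>.\<close>

lemma scan_stack_bound:
  assumes "scan_inv j cur sp S T"
  shows "p + sp < j"
proof -
  have "p + k \<le> S k" if "k \<le> sp" for k
    using that
  proof (induction k)
    case (Suc k)
    then have "S k < S (Suc k)" using assms unfolding scan_inv_def by simp
    then show ?case using Suc by simp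
  qed (use assms in \<open>auto simp: scan_inv_def\<close>)
  from this[of sp] show ?thesis using assms unfolding scan_inv_def by fastforce
qed

context
  fixes j cur sp S T
  assumes inv: "scan_inv j cur sp S T" and j: "j \<le> p + n"
begin

lemmas scan = inv[unfolded scan_inv_def]

lemma scan_range: "p \<le> i \<Longrightarrow> i \<le> j \<Longrightarrow> 1 \<le> i \<and> i \<le> 2 * n"
  using p j by simp

lemma scan_greedy: "p \<le> x \<Longrightarrow> x < y \<Longrightarrow> y < j \<Longrightarrow> T x + touch_angle (b x) (b y) \<le> T y"
  using scan unfolding greedy_angles_def by blast

text \<open>Going through \<open>x\<close> is never worse: \<open>T i\<close> is at most
  \<open>T x\<close> by the constraint between them, and the angle to \<open>j\<close> grows with
  the coefficient.\<close>

lemma scan_dominated: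
  assumes "p \<le> i" "i \<le> x" "x < j" "b i \<le> b x"
  shows "T i + touch_angle (b i) (b j) \<le> T x + touch_angle (b x) (b j)"
proof (cases "i = x")
  case False
  then have "T i + touch_angle (b i) (b x) \<le> T x" "0 < touch_angle (b i) (b x)"
    using assms scan_greedy[of i x] scan_range[of i] scan_range[of x] angle_bounds[of i x] by auto
  moreover have "touch_angle (b i) (b j) \<le> touch_angle (b x) (b j)"
    using assms scan_range[of i] scan_range[of x] scan_range[of j] by (intro angle_mono_left) auto
  ultimately show ?thesis by linarith
qed simp

lemma scan_stack_mono: "k \<le> l \<Longrightarrow> l \<le> sp \<Longrightarrow> S k \<le> S l \<and> b (S l) \<le> b (S k)"
proof (induction l rule: dec_induct)
  case (step l)
  then have "S l < S (Suc l)" "b (S (Suc l)) \<le> b (S l)" using scan by auto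
  then show ?case using step by auto
qed simp

lemma scan_top: "p \<le> S sp" "S sp < j"
  using scan by auto

abbreviation "top_bound \<equiv> max cur (T (S sp) + touch_angle (b (S sp)) (b j))"

text \<open>The value 0 of \<open>cur\<close> stands for no bound recorded yet. It is never the
  maximum, because the bound from the stack top is positive.\<close>

lemma top_bound_tight:
  obtains i where "p \<le> i" "i < j" "top_bound = T i + touch_angle (b i) (b j)"
proof (cases "cur \<le> T (S sp) + touch_angle (b (S sp)) (b j)")
  case True
  then show ?thesis using that[of "S sp"] scan_top by auto
next
  case False
  have "0 \<le> T (S sp)"
    using scan_greedy[of p "S sp"] scan_top angle_bounds(1)[of p "S sp"] scan_range[of p] scan_range[of "S sp"] scan
    unfolding greedy_angles_def by (cases "S sp = p") auto
  moreover have "0 < touch_angle (b (S sp)) (b j)"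
    using scan_top scan_range[of "S sp"] scan_range[of j] by (intro angle_bounds) auto
  ultimately have "cur \<noteq> 0" using False by linarith
  then obtain i where "p \<le> i" "i < j" "cur = T i + touch_angle (b i) (b j)" using scan by blast
  then show ?thesis using that[of i] False by (simp add: max_def)
qed

text \<open>No coefficient exceeds that of \<open>p\<close>, so the bottom is never popped. A
  position represented only by the popped top is bounded through it by
  \<open>scan_dominated\<close>; its bound is thus contained in the maximum, and its coefficient is
  below that of \<open>j\<close>.\<close>

lemma scan_pop:
  assumes "b (S sp) < b j"
  shows "0 < sp" "scan_inv j top_bound (sp - 1) S T"
proof -
  show sp: "0 < sp"
  proof (rule ccontr)
    assume "\<not> 0 < sp"
    then have "S sp = p" using scan by simp
    then show False using assms b_le[of j] scan_range[of j] scan by auto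
  qed
  have cover: "(b i \<le> b j \<and> T i + touch_angle (b i) (b j) \<le> top_bound) \<or>
      (\<exists>k\<le>sp - 1. i \<le> S k \<and> b i \<le> b (S k))" if i: "p \<le> i" "i < j" for i
  proof -
    from i scan consider "b i \<le> b j" "T i + touch_angle (b i) (b j) \<le> cur"
      | k where "k \<le> sp" "i \<le> S k" "b i \<le> b (S k)" by blast
    then show ?thesis
    proof cases
      case 1
      then show ?thesis by auto
    next
      case 2
      show ?thesis
      proof (cases "k = sp")
        case True
        have "T i + touch_angle (b i) (b j) \<le> T (S sp) + touch_angle (b (S sp)) (b j)"
          using 2 True i scan_top by (intro scan_dominated) auto
        then show ?thesis using 2 True assms by auto
      next
        case False
        then have "k \<le> sp - 1" using 2 by simp
        then show ?thesis using 2 by blast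
      qed
    qed
  qed
  obtain i where i: "p \<le> i" "i < j" "top_bound = T i + touch_angle (b i) (b j)" by (rule top_bound_tight)
  show "scan_inv j top_bound (sp - 1) S T"
    unfolding scan_inv_def
    using scan cover i sp by (intro conjI) auto
qed

text \<open>A deeper stack entry is already separated from the top by at least the angle it needs to
  \<open>j\<close>, since \<open>b j\<close> is at most the coefficient of the top. So the top
  decides, together with \<open>cur\<close>, which accounts for the popped positions.\<close>

lemma scan_push:
  assumes le: "b j \<le> b (S sp)"
  shows "scan_inv (j + 1) 0 (sp + 1) (S(sp + 1 := j)) (T(j := top_bound))"
proof -
  let ?S = "S(sp + 1 := j)" and ?T = "T(j := top_bound)"
  have bound: "T i + touch_angle (b i) (b j) \<le> top_bound" if i: "p \<le> i" "i < j" for i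
  proof -
    from i scan consider "T i + touch_angle (b i) (b j) \<le> cur"
      | k where "k \<le> sp" "i \<le> S k" "b i \<le> b (S k)" by blast
    then show ?thesis
    proof cases
      case 1
      then show ?thesis by auto
    next
      case 2
      have k: "S k \<le> S sp" "b (S sp) \<le> b (S k)" "p \<le> S k" "S k < j"
        using scan_stack_mono[of k sp] 2 scan by auto
      have "T i + touch_angle (b i) (b j) \<le> T (S k) + touch_angle (b (S k)) (b j)"
        using 2 i k by (intro scan_dominated) auto
      also have "\<dots> \<le> T (S sp) + touch_angle (b (S sp)) (b j)"
      proof (cases "S k = S sp")
        case False
        have "touch_angle (b (S k)) (b j) \<le> touch_angle (b (S k)) (b (S sp))"
          using k le scan_top scan_range[of "S k"] scan_range[of "S sp"] scan_range[of j]
          by (intro angle_mono_right) auto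
        moreover have "T (S k) + touch_angle (b (S k)) (b (S sp)) \<le> T (S sp)"
          using False k scan_top by (intro scan_greedy) auto
        moreover have "0 < touch_angle (b (S sp)) (b j)"
          using scan_top scan_range[of "S sp"] scan_range[of j] by (intro angle_bounds) auto
        ultimately show ?thesis by linarith
      qed simp
      also have "\<dots> \<le> top_bound" by auto
      finally show ?thesis .
    qed
  qed
  obtain i0 where i0: "p \<le> i0" "i0 < j" "top_bound = T i0 + touch_angle (b i0) (b j)"
    by (rule top_bound_tight)
  have greedy: "greedy_angles n a p (j + 1) ?T"
    unfolding greedy_angles_def
  proof (intro conjI allI impI)
    show "?T p = 0" using scan unfolding greedy_angles_def by auto
  next
    fix x y assume "p \<le> x \<and> x < y \<and> y < j + 1"
    then show "?T x + touch_angle (b x) (b y) \<le> ?T y"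
      using bound[of x] scan_greedy[of x y] by (cases "y = j") auto
  next
    fix y assume y: "p < y \<and> y < j + 1"
    show "\<exists>x. p \<le> x \<and> x < y \<and> ?T y = ?T x + touch_angle (b x) (b y)"
    proof (cases "y = j")
      case True
      then show ?thesis using i0 by (intro exI[of _ i0]) auto
    next
      case False
      then obtain x where "p \<le> x" "x < y" "T y = T x + touch_angle (b x) (b y)"
        using scan y unfolding greedy_angles_def by (metis Suc_eq_plus1 less_Suc_eq)
      then show ?thesis using False y by (intro exI[of _ x]) auto
    qed
  qed
  \<comment> \<open>A position handled only through \<open>cur\<close> has coefficient at most
    \<open>b j\<close>. The new top \<open>j\<close> represents it from now on, so
    \<open>cur\<close> can restart at 0.\<close>
  have cover: "\<exists>k\<le>sp + 1. i \<le> ?S k \<and> b i \<le> b (?S k)" if i: "p \<le> i" "i < j + 1" for i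
  proof -
    consider "i = j" | "i < j" "b i \<le> b j" | k where "k \<le> sp" "i \<le> S k" "b i \<le> b (S k)"
      using scan i by (metis Suc_eq_plus1 less_Suc_eq)
    then show ?thesis
    proof cases
      case 3
      then show ?thesis by (intro exI[of _ k]) auto
    qed (auto intro!: exI[of _ "sp + 1"])
  qed
  show ?thesis
    unfolding scan_inv_def
  proof (intro conjI)
    show "\<forall>k\<le>sp + 1. p \<le> ?S k \<and> ?S k < j + 1"
      using scan by (auto simp: le_Suc_eq less_Suc_eq)
    show "\<forall>k<sp + 1. ?S k < ?S (Suc k) \<and> b (?S (Suc k)) \<le> b (?S k)"
      using scan le scan_top by (auto simp: less_Suc_eq)
    show "\<forall>i. p \<le> i \<and> i < j + 1 \<longrightarrow>
        b i \<le> b (j + 1) \<and> ?T i + touch_angle (b i) (b (j + 1)) \<le> 0 \<or>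
        (\<exists>k\<le>sp + 1. i \<le> ?S k \<and> b i \<le> b (?S k))"
      using cover by blast
  qed (use greedy scan j in auto)
qed

end

lemma scan_inv_done: "scan_inv j cur sp S T \<Longrightarrow> p + n < j \<Longrightarrow> greedy_angles n a p (p + n + 1) T"
  unfolding scan_inv_def by (metis Suc_eq_plus1 le_antisym Suc_leI)

end

section \<open>The program\<close>

text \<open>Registers are the cells below 24. Register 0 holds the base \<open>64 * n\<close>, 2 holds \<open>n\<close>, 3 holds 1,
  7 holds \<open>w 0\<close>, and 8 to 11 hold the bases of the arrays of coefficients, angles, stacked
  positions and outputs. Registers 4, 5, 6, 12, 13 are the loop variables, the remaining ones are
  scratch cells.\<close>

primrec save_regs :: "nat list \<Rightarrow> com" where
  "save_regs [] = block []"
| "save_regs (i # is) = block [Const 1 (int i), Add 1 1 0, Store 1 i] ;; save_regs is"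

primrec restore_regs :: "nat list \<Rightarrow> com" where
  "restore_regs [] = block []"
| "restore_regs (i # is) = block [Const 1 (int i), Add 1 1 0, Load i 1] ;; restore_regs is"

text \<open>\<open>n\<close> is recovered by dividing the base by 64. The shift starts at cell 24,
  beyond the registers already saved, and ends at cell \<open>n + 1\<close>.\<close>

definition "setup_code = block [Const 1 64, Div 2 0 1, Const 3 1, Load 7 0, Add 8 0 0, Add 9 8 0,
  Add 10 9 0, Add 11 10 0, Const 4 24, Add 13 2 3]"

definition "shift_body = block [Load 14 4, Add 1 0 4, Store 1 14, Add 4 4 3]"

definition "coeff_init = block [Const 4 1, Const 6 0]"

text \<open>Each coefficient is stored for both turns; cells 5 and 6 keep the index and the value of
  the largest one so far.\<close>

definition "coeff_body =
  block [Add 1 0 4, Add 1 1 3, Load 14 1, Add 15 7 14, Div 15 14 15, Sqrt 15 15,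
    Add 1 8 4, Store 1 15, Add 1 1 2, Store 1 15] ;;
  Cond 6 15 (block [Copy 6 15, Copy 5 4]) (block []) ;;
  block [Add 4 4 3]"

definition "scan_init = block [Add 1 9 5, Const 14 0, Store 1 14, Store 10 5, Add 4 5 3,
  Const 6 0, Const 12 0, Add 13 5 2]"

text \<open>One stack comparison per round: either the angle of \<open>j\<close> is fixed and
  \<open>j\<close> is pushed, or a smaller top is popped. Cells 4, 6 and 12 are \<open>j\<close>,
  \<open>cur\<close> and \<open>sp\<close>.\<close>

definition "scan_body =
  block [Add 1 10 12, Load 14 1, Add 1 8 14, Load 15 1, Add 1 8 4, Load 16 1, Add 1 9 14, Load 17 1,
    Mul 18 15 16, Arcsin 18 18, Add 18 18 18, Add 18 17 18] ;;
  Cond 6 18 (block [Copy 6 18]) (block []) ;;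
  Cond 16 15
    (block [Add 1 9 4, Store 1 6, Add 12 12 3, Add 1 10 12, Store 1 4, Add 4 4 3, Const 6 0])
    (block [Sub 12 12 3])"

text \<open>Cell 20 receives \<open>2 * pi\<close> as four times \<open>arcsin 1\<close>.\<close>

definition "decide_init = block [Add 1 9 13, Load 14 1, Arcsin 20 3, Add 20 20 20, Add 20 20 20]"

text \<open>Cell 20 becomes the stretch factor. The centre is written first, and cell 12 always
  points to the last output cell written.\<close>

definition "output_init = block [Div 20 20 14, Const 14 0, Add 1 11 3, Store 1 14, Add 1 1 3, Store 1 14,
  Add 1 1 3, Store 1 7, Copy 12 1, Const 4 1]"

text \<open>Turning back by \<open>2 * pi\<close> is omitted for the leaves before \<open>p\<close>,
  since sine and cosine are periodic.\<close>

definition "output_body =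
  block [Add 1 0 4, Add 1 1 3, Load 14 1, Add 1 9 4] ;;
  Cond 5 4 (block []) (block [Add 1 1 2]) ;;
  block [Load 15 1, Mul 15 15 20, Add 16 7 14, Cos 17 15, Mul 17 16 17, Sin 18 15, Mul 18 16 18,
    Add 12 12 3, Store 12 17, Add 12 12 3, Store 12 18, Add 12 12 3, Store 12 14, Add 4 4 3]"

definition "copy_init = block [Const 4 24, Sub 13 12 11]"

definition "copy_body = block [Add 1 11 4, Load 14 1, Store 4 14, Add 4 4 3]"

text \<open>Cells 2 to 23 wait until the registers are no longer read. Cell 1 serves as address
  until its own value is loaded, and cell 0 as base until it receives the answer.\<close>

definition "finish_code = block [Copy 0 11] ;; restore_regs (rev [2..<24]) ;;
  block [Const 1 1, Add 1 1 0, Load 1 1, Const 0 1]"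

definition "emit_code = output_init ;; While 4 2 output_body ;; copy_init ;; While 4 13 copy_body ;; finish_code"

definition "leaves_code =
  save_regs [2..<24] ;; setup_code ;; While 4 13 shift_body ;;
  coeff_init ;; While 4 2 coeff_body ;;
  scan_init ;; While 4 13 scan_body ;;
  decide_init ;; Cond 20 14 (block [Const 0 0]) emit_code"

text \<open>No cell is known to be free at the start: cell 0 itself becomes the address \<open>64 * n\<close> at which
  \<open>w 0\<close> is saved, which frees cell 1. Cell 2 then vanishes exactly if \<open>n = 0\<close>, and in that case
  \<open>w 0\<close> was saved to cell 0.\<close>

definition "star_code =
  block [Add 0 0 0, Add 0 0 0, Add 0 0 0, Add 0 0 0, Add 0 0 0, Add 0 0 0, Store 0 1, Const 1 0] ;;
  Cond 2 1 (block [Copy 3 0, Const 0 1]) leaves_code"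

section \<open>Symbolic execution of the loop bodies\<close>

lemma wp_save_regs:
  assumes "m 0 = real B" "\<forall>i\<in>set is. 2 \<le> i \<and> i < B" "distinct is"
    and "\<And>m'. \<forall>i\<in>set is. m' (B + i) = m i \<Longrightarrow>
      \<forall>x. x \<noteq> 1 \<longrightarrow> x \<notin> (+) B ` set is \<longrightarrow> m' x = m x \<Longrightarrow> Q m'"
  shows "wp (save_regs is) Q m"
  using assms
proof (induction "is" arbitrary: m)
  case Nil
  then show ?case by simp
next
  case (Cons i "is")
  have i: "2 \<le> i" "i < B" using Cons.prems by auto
  let ?m = "m(1 := real i + real B, B + i := m i)"
  have "wp (save_regs is) Q ?m"
  proof (rule Cons.IH)
    fix m' assume m': "\<forall>i\<in>set is. m' (B + i) = ?m i" and
      other: "\<forall>x. x \<noteq> 1 \<longrightarrow> x \<notin> (+) B ` set is \<longrightarrow> m' x = ?m x"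
    show "Q m'"
    proof (rule Cons.prems(4))
      show "\<forall>x\<in>set (i # is). m' (B + x) = m x"
        using m' other[rule_format, of "B + i"] Cons.prems(2,3) i by fastforce
      show "\<forall>x. x \<noteq> 1 \<longrightarrow> x \<notin> (+) B ` set (i # is) \<longrightarrow> m' x = m x"
        using other by auto
    qed
  qed (use Cons.prems i in auto)
  then show ?case using Cons.prems(1) i by (simp add: add.commute)
qed

lemma wp_restore_regs:
  assumes "m 0 = real B" "\<forall>i\<in>set is. 2 \<le> i \<and> i < B" "distinct is"
    and "\<And>m'. \<forall>i\<in>set is. m' i = m (B + i) \<Longrightarrow>
      \<forall>x. x \<noteq> 1 \<longrightarrow> x \<notin> set is \<longrightarrow> m' x = m x \<Longrightarrow> Q m'"
  shows "wp (restore_regs is) Q m"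
  using assms
proof (induction "is" arbitrary: m)
  case Nil
  then show ?case by simp
next
  case (Cons i "is")
  have i: "2 \<le> i" "i < B" using Cons.prems by auto
  let ?m = "m(1 := real i + real B, i := m (B + i))"
  have "wp (restore_regs is) Q ?m"
  proof (rule Cons.IH)
    fix m' assume m': "\<forall>i\<in>set is. m' i = ?m (B + i)" "\<forall>x. x \<noteq> 1 \<longrightarrow> x \<notin> set is \<longrightarrow> m' x = ?m x"
    show "Q m'"
    proof (rule Cons.prems(4))
      show "\<forall>x\<in>set (i # is). m' x = m (B + x)"
        using m' Cons.prems(2,3) i by auto
      show "\<forall>x. x \<noteq> 1 \<longrightarrow> x \<notin> set (i # is) \<longrightarrow> m' x = m x"
        using m' by auto
    qed
  qed (use Cons.prems i in auto)
  then show ?case using Cons.prems(1) i by (simp add: add.commute)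
qed

lemma cost_save_regs: "cost (save_regs is) = 3 * length is + 1"
  by (induction "is") auto

lemma cost_restore_regs: "cost (restore_regs is) = 3 * length is + 1"
  by (induction "is") auto

text \<open>Array contents enter as plain parameters, and the result is described by the cells that
  may have changed; this keeps the execution apart from the invariants. The two claims are pop and
  push.\<close>

lemma wp_scan_body:
  assumes "\<bar>u * v\<bar> \<le> 1" "m 3 = 1" "m 8 = real B2" "m 9 = real B3" "m 10 = real B4" "m 4 = real j"
    "m 6 = cur" "m 12 = real sp" "m (B4 + sp) = real i" "m (B2 + i) = u" "m (B2 + j) = v" "m (B3 + i) = t"
    "24 \<le> B2" "24 \<le> B3" "24 \<le> B4" "B3 + j < B4"
  defines "cur' \<equiv> max cur (t + 2 * arcsin (u * v))"
  shows "u < v \<Longrightarrow>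
      (\<And>m'. \<forall>x. x \<notin> {1, 6, 12, 14, 15, 16, 17, 18} \<longrightarrow> m' x = m x \<Longrightarrow>
          m' 6 = cur' \<Longrightarrow> m' 12 = real sp - 1 \<Longrightarrow> Q m') \<Longrightarrow> wp scan_body Q m"
    and "v \<le> u \<Longrightarrow>
      (\<And>m'. \<forall>x. x \<notin> {1, 4, 6, 12, 14, 15, 16, 17, 18, B3 + j, B4 + (sp + 1)} \<longrightarrow> m' x = m x \<Longrightarrow>
          m' 4 = real j + 1 \<Longrightarrow> m' 6 = 0 \<Longrightarrow> m' 12 = real sp + 1 \<Longrightarrow>
          m' (B3 + j) = cur' \<Longrightarrow> m' (B4 + (sp + 1)) = real j \<Longrightarrow> Q m') \<Longrightarrow> wp scan_body Q m"
proof -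
  define d where "d = t + 2 * arcsin (u * v)"
  {
    assume lt: "u < v" and Q: "\<And>m'. \<forall>x. x \<notin> {1, 6, 12, 14, 15, 16, 17, 18} \<longrightarrow> m' x = m x \<Longrightarrow>
          m' 6 = cur' \<Longrightarrow> m' 12 = real sp - 1 \<Longrightarrow> Q m'"
    show "wp scan_body Q m"
    proof (cases "cur \<le> d")
      case True
      then have "cur' = d" by (simp add: cur'_def d_def)
      then show ?thesis
        using assms(1-16) lt True d_def[symmetric] unfolding scan_body_def by simp (rule Q; simp)
    next
      case False
      then have "cur' = cur" by (simp add: cur'_def d_def)
      then show ?thesis
        using assms(1-16) lt False d_def[symmetric] unfolding scan_body_def by simp (rule Q; simp)
    qed
  }
  {
    assume ge: "v \<le> u" and Q: "\<And>m'. \<forall>x. x \<notin> {1, 4, 6, 12, 14, 15, 16, 17, 18, B3 + j, B4 + (sp + 1)} \<longrightarrow> m' x = m x \<Longrightarrow>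
          m' 4 = real j + 1 \<Longrightarrow> m' 6 = 0 \<Longrightarrow> m' 12 = real sp + 1 \<Longrightarrow>
          m' (B3 + j) = cur' \<Longrightarrow> m' (B4 + (sp + 1)) = real j \<Longrightarrow> Q m'"
    show "wp scan_body Q m"
    proof (cases "cur \<le> d")
      case True
      then have "cur' = d" by (simp add: cur'_def d_def)
      then show ?thesis
        using assms(1-16) ge True d_def[symmetric] unfolding scan_body_def by simp (rule Q; simp)
    next
      case False
      then have "cur' = cur" by (simp add: cur'_def d_def)
      then show ?thesis
        using assms(1-16) ge False d_def[symmetric] unfolding scan_body_def by simp (rule Q; simp)
    qed
  }
qed

lemma wp_output_body:
  assumes "m 0 = real B1" "m 2 = real n" "m 3 = 1" "m 7 = v" "m 9 = real B3" "m 4 = real i" "m 5 = real p"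
    "m 12 = real q" "m 20 = l" "m (B1 + i + 1) = u" "m (B3 + (if p \<le> i then i else i + n)) = t"
    "24 \<le> B1" "24 \<le> B3" "24 \<le> q"
    and Q: "\<And>m'. \<forall>x. x \<notin> {1, 4, 12, 14, 15, 16, 17, 18, q + 1, q + 2, q + 3} \<longrightarrow> m' x = m x \<Longrightarrow>
      m' 4 = real i + 1 \<Longrightarrow> m' 12 = real q + 3 \<Longrightarrow> m' (q + 1) = (v + u) * cos (t * l) \<Longrightarrow>
      m' (q + 2) = (v + u) * sin (t * l) \<Longrightarrow> m' (q + 3) = u \<Longrightarrow> Q m'"
  shows "wp output_body Q m"
proof (cases "p \<le> i")
  case True
  then show ?thesis using assms(1-14) unfolding output_body_def by simp (rule Q; simp)
next
  case False
  then show ?thesis using assms(1-14) unfolding output_body_def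
    by (simp add: add.assoc[symmetric]) (rule Q; simp)
qed

section \<open>Memory layout and invariants of the phases\<close>

locale star_memory =
  fixes n :: nat and w :: "nat \<Rightarrow> real" and B1 B2 B3 B4 B5 :: nat
  assumes n: "1 \<le> n"
    and w: "\<And>i. i \<le> n \<Longrightarrow> 0 < w i"
    \<comment> \<open>Offsets reach \<open>3 * n + 3\<close> in the output and \<open>2 * n\<close>
      for coefficients and angles, so these distances keep the arrays apart.\<close>
    and bases: "64 \<le> B1" "3 * n + 4 \<le> B1" "B1 + 3 * n + 4 \<le> B2" "B2 + 3 * n + 4 \<le> B3"
      "B3 + 3 * n + 4 \<le> B4" "B4 + 3 * n + 4 \<le> B5"
begin

definition frame :: "(nat \<Rightarrow> real) \<Rightarrow> bool" where
  "frame m \<longleftrightarrow> m 0 = real B1 \<and> m 2 = real n \<and> m 3 = 1 \<and> m 7 = w 0 \<and> m 8 = real B2 \<and>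
     m 9 = real B3 \<and> m 10 = real B4 \<and> m 11 = real B5"

definition weights :: "(nat \<Rightarrow> real) \<Rightarrow> bool" where
  "weights m \<longleftrightarrow> (\<forall>i. 1 \<le> i \<and> i \<le> n \<longrightarrow> m (B1 + i + 1) = w i)"

definition coeffs :: "(nat \<Rightarrow> real) \<Rightarrow> bool" where
  "coeffs m \<longleftrightarrow> (\<forall>x. 1 \<le> x \<and> x \<le> 2 * n \<longrightarrow> m (B2 + x) = cyclic_ext n (leaf_coeff w) x)"

text \<open>At the start \<open>i = 24\<close>, and the weights in lower cells have already been
  saved with the registers. For small \<open>n\<close> the loop body never runs.\<close>

definition shift_mem :: "nat \<Rightarrow> (nat \<Rightarrow> real) \<Rightarrow> bool" where
  "shift_mem i m \<longleftrightarrow> frame m \<and> m 4 = real i \<and> m 13 = real n + 1 \<and> 24 \<le> i \<and>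
     (\<forall>c. 2 \<le> c \<and> c < i \<and> c \<le> n + 1 \<longrightarrow> m (B1 + c) = w (c - 1)) \<and>
     (\<forall>c. i \<le> c \<and> c \<le> n + 1 \<longrightarrow> m c = w (c - 1))"

lemma shift_body:
  assumes "shift_mem i m" "m 4 \<le> m 13"
  shows "wp shift_body (shift_mem (i + 1)) m"
proof -
  have i: "i \<le> n + 1" "24 \<le> i" using assms by (auto simp: shift_mem_def)
  show ?thesis
    using assms i bases n unfolding shift_mem_def frame_def shift_body_def
    by (auto simp: less_Suc_eq)
qed

lemma shift_loop:
  assumes "shift_mem 24 m"
  shows "terminates (While 4 13 shift_body) (6 * n + 14) (\<lambda>m. frame m \<and> weights m) m"
proof -
  have "terminates (While 4 13 shift_body) ((cost shift_body + 2) * (n + 2 - 24) + 2) (\<lambda>m. frame m \<and> weights m) m"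
  proof (rule terminates_While[of shift_mem _ _ _ _ "\<lambda>i. n + 2 - i", OF _ assms])
    fix i m assume i: "shift_mem i m" and le: "m 4 \<le> m 13"
    then have "i \<le> n + 1" by (auto simp: shift_mem_def)
    then show "terminates shift_body (cost shift_body) (\<lambda>m'. \<exists>i'. shift_mem i' m' \<and> n + 2 - i' < n + 2 - i) m"
      by (intro terminates_mono[OF terminates_loop_free[OF shift_body[OF i le]]] exI[of _ "i + 1"]) auto
  next
    fix i m assume mem: "shift_mem i m" and "\<not> m 4 \<le> m 13"
    then have "n + 1 < i" by (auto simp: shift_mem_def)
    then have "m (B1 + (x + 1)) = w (x + 1 - 1)" if "1 \<le> x" "x \<le> n" for x
      using mem that unfolding shift_mem_def by (elim conjE allE[of _ "x + 1"]) simp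
    then show "frame m \<and> weights m"
      using mem by (simp add: shift_mem_def weights_def)
  qed
  then show ?thesis by (rule terminates_mono) (auto simp: shift_body_def)
qed

text \<open>Before the first leaf cell 6 is 0 and cell 5 is arbitrary; coefficients are positive, so
  the first leaf always becomes the initial maximum.\<close>

definition coeff_mem :: "nat \<Rightarrow> (nat \<Rightarrow> real) \<Rightarrow> bool" where
  "coeff_mem i m \<longleftrightarrow> frame m \<and> weights m \<and> m 4 = real i \<and> 1 \<le> i \<and> i \<le> n + 1 \<and>
     (\<forall>x. 1 \<le> x \<and> x < i \<longrightarrow> m (B2 + x) = leaf_coeff w x \<and> m (B2 + x + n) = leaf_coeff w x) \<and>
     (i = 1 \<longrightarrow> m 6 = 0) \<and>
     (1 < i \<longrightarrow> (\<exists>p. 1 \<le> p \<and> p < i \<and> m 5 = real p \<and> m 6 = leaf_coeff w p \<and>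
        (\<forall>x. 1 \<le> x \<and> x < i \<longrightarrow> leaf_coeff w x \<le> leaf_coeff w p)))"

lemma coeff_body:
  assumes mem: "coeff_mem i m" and "m 4 \<le> m 2"
  shows "wp coeff_body (coeff_mem (i + 1)) m"
proof -
  have i: "i \<le> n" "1 \<le> i" using assms by (auto simp: coeff_mem_def frame_def)
  have pos: "0 < w 0" "0 < w i" "w 0 + w i \<noteq> 0" "0 \<le> w i / (w 0 + w i)" using i w[of 0] w[of i] by auto
  have a: "sqrt (w i / (w 0 + w i)) = leaf_coeff w i" "0 < leaf_coeff w i"
    using leaf_coeff_bounds[of w i] pos by (auto simp: leaf_coeff_def)
  have mi: "m (B1 + i + 1) = w i" using mem i by (auto simp: coeff_mem_def weights_def)
  show ?thesis
  proof (cases "m 6 \<le> leaf_coeff w i")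
    case True
    have mx: "\<forall>x. 1 \<le> x \<and> x < i + 1 \<longrightarrow> leaf_coeff w x \<le> leaf_coeff w i"
      using mem True i by (fastforce simp: coeff_mem_def less_Suc_eq)
    show ?thesis
      using mem i bases n True mi pos a mx unfolding coeff_body_def coeff_mem_def frame_def weights_def
      by (auto simp: less_Suc_eq)
  next
    case False
    have "i \<noteq> 1" using mem False a by (auto simp: coeff_mem_def)
    then have "1 < i" using i by simp
    then obtain p where pp: "1 \<le> p" "p < i" "m 5 = real p" "m 6 = leaf_coeff w p"
      "\<forall>x. 1 \<le> x \<and> x < i \<longrightarrow> leaf_coeff w x \<le> leaf_coeff w p"
      using mem by (auto simp: coeff_mem_def)
    have mx: "\<forall>x. 1 \<le> x \<and> x < i + 1 \<longrightarrow> leaf_coeff w x \<le> leaf_coeff w p"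
      using pp False by (auto simp: less_Suc_eq)
    show ?thesis
      using mem i bases n False mi pos a mx pp(1-4) unfolding coeff_body_def coeff_mem_def frame_def weights_def
      by (auto simp: less_Suc_eq)
  qed
qed

definition coeff_done :: "nat \<Rightarrow> (nat \<Rightarrow> real) \<Rightarrow> bool" where
  "coeff_done p m \<longleftrightarrow> frame m \<and> weights m \<and> coeffs m \<and> m 5 = real p"

lemma coeff_loop:
  assumes "coeff_mem 1 m"
  shows "terminates (While 4 2 coeff_body) (18 * n + 2)
    (\<lambda>m. \<exists>p. leaf_cycle n (leaf_coeff w) p \<and> coeff_done p m) m"
proof -
  have "terminates (While 4 2 coeff_body) ((cost coeff_body + 2) * (n + 1 - 1) + 2)
    (\<lambda>m. \<exists>p. leaf_cycle n (leaf_coeff w) p \<and> coeff_done p m) m"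
  proof (rule terminates_While[of coeff_mem _ _ _ _ "\<lambda>i. n + 1 - i", OF _ assms])
    fix i m assume i: "coeff_mem i m" and le: "m 4 \<le> m 2"
    then have "i \<le> n" by (auto simp: coeff_mem_def frame_def)
    then show "terminates coeff_body (cost coeff_body) (\<lambda>m'. \<exists>i'. coeff_mem i' m' \<and> n + 1 - i' < n + 1 - i) m"
      by (intro terminates_mono[OF terminates_loop_free[OF coeff_body[OF i le]]] exI[of _ "i + 1"]) auto
  next
    fix i m assume mem: "coeff_mem i m" and "\<not> m 4 \<le> m 2"
    then have "i = n + 1" by (auto simp: coeff_mem_def frame_def)
    with mem have mem: "coeff_mem (n + 1) m" by simp
    then obtain p where p: "1 \<le> p" "p \<le> n" "m 5 = real p"
      "\<forall>x. 1 \<le> x \<and> x \<le> n \<longrightarrow> leaf_coeff w x \<le> leaf_coeff w p"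
      using n by (auto simp: coeff_mem_def less_Suc_eq_le)
    have "leaf_cycle n (leaf_coeff w) p"
      using p leaf_coeff_bounds w by unfold_locales auto
    moreover have "m (B2 + x) = cyclic_ext n (leaf_coeff w) x" if x: "1 \<le> x" "x \<le> 2 * n" for x
    proof (cases "x \<le> n")
      case True
      then show ?thesis using mem x by (simp add: coeff_mem_def cyclic_ext_def)
    next
      case False
      then have "1 \<le> x - n" "x - n < n + 1" "B2 + (x - n) + n = B2 + x" using x by auto
      moreover from this(1,2) have "m (B2 + (x - n) + n) = leaf_coeff w (x - n)"
        using mem unfolding coeff_mem_def by blast
      ultimately show ?thesis using False by (simp add: cyclic_ext_def)
    qed
    ultimately show "\<exists>p. leaf_cycle n (leaf_coeff w) p \<and> coeff_done p m"
      using mem p by (auto simp: coeff_done_def coeffs_def coeff_mem_def)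
  qed
  then show ?thesis by (rule terminates_mono) (auto simp: coeff_body_def)
qed


definition scan_mem :: "nat \<Rightarrow> nat \<Rightarrow> real \<Rightarrow> nat \<Rightarrow> (nat \<Rightarrow> nat) \<Rightarrow> (nat \<Rightarrow> real) \<Rightarrow> (nat \<Rightarrow> real) \<Rightarrow> bool" where
  "scan_mem p j cur sp S T m \<longleftrightarrow> frame m \<and> weights m \<and> coeffs m \<and> m 5 = real p \<and> m 13 = real p + real n \<and>
     m 4 = real j \<and> m 6 = cur \<and> m 12 = real sp \<and>
     (\<forall>k\<le>sp. m (B4 + k) = real (S k)) \<and> (\<forall>x. p \<le> x \<and> x < j \<longrightarrow> m (B3 + x) = T x)"

definition scan_done :: "nat \<Rightarrow> (nat \<Rightarrow> real) \<Rightarrow> (nat \<Rightarrow> real) \<Rightarrow> bool" where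
  "scan_done p T m \<longleftrightarrow> frame m \<and> weights m \<and> m 5 = real p \<and> m 13 = real p + real n \<and>
     (\<forall>x. p \<le> x \<and> x \<le> p + n \<longrightarrow> m (B3 + x) = T x)"

context
  fixes p
  assumes cycle: "leaf_cycle n (leaf_coeff w) p"
begin

interpretation leaf_cycle n "leaf_coeff w" p by (rule cycle)

lemma scan_init:
  assumes "coeff_done p m"
  shows "wp scan_init (scan_mem p (p + 1) 0 0 (\<lambda>_. p) (\<lambda>_. 0)) m"
  using assms bases n p
  unfolding coeff_done_def scan_init_def scan_mem_def frame_def weights_def coeffs_def
  by auto

lemma scan_body:
  assumes inv: "scan_inv j cur sp S T" and mem: "scan_mem p j cur sp S T m" and le: "m 4 \<le> m 13"
  defines "cur' \<equiv> max cur (T (S sp) + touch_angle (b (S sp)) (b j))"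
  shows "b (S sp) < b j \<Longrightarrow> wp scan_body (scan_mem p j cur' (sp - 1) S T) m"
    and "b j \<le> b (S sp) \<Longrightarrow>
      wp scan_body (scan_mem p (j + 1) 0 (sp + 1) (S(sp + 1 := j)) (T(j := cur'))) m"
proof -
  have "real j \<le> real (p + n)" using le mem by (simp add: scan_mem_def)
  then have j: "j \<le> p + n" by (simp only: of_nat_le_iff)
  have sp: "p + sp < j" by (rule scan_stack_bound[OF inv])
  have top: "p \<le> S sp" "S sp < j" using scan_top[OF inv j] by auto
  have range: "1 \<le> S sp" "S sp \<le> 2 * n" "1 \<le> j" "j \<le> 2 * n" using j top p by auto
  have ab: "\<bar>b (S sp) * b j\<bar> \<le> 1"
    using mult_bounds[of "b (S sp)" "b j"] b_bounds[OF range(1,2)] b_bounds[OF range(3,4)] by auto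
  have regs: "m 3 = 1" "m 8 = real B2" "m 9 = real B3" "m 10 = real B4" "m 4 = real j" "m 6 = cur" "m 12 = real sp"
    "m (B4 + sp) = real (S sp)" "m (B2 + S sp) = b (S sp)" "m (B2 + j) = b j" "m (B3 + S sp) = T (S sp)"
    using mem range top by (auto simp: scan_mem_def coeffs_def frame_def)
  have B: "24 \<le> B2" "24 \<le> B3" "24 \<le> B4" "B3 + j < B4" using bases j p by auto
  note eff = wp_scan_body[OF ab regs B, folded touch_angle_def, folded cur'_def]
  have sets: "\<forall>x. 1 \<le> x \<and> x \<le> n \<longrightarrow> B1 + x + 1 \<noteq> B3 + j \<and> B1 + x + 1 \<noteq> B4 + (sp + 1) \<and> 24 \<le> B1 + x + 1"
    "\<forall>x. 1 \<le> x \<and> x \<le> 2 * n \<longrightarrow> B2 + x \<noteq> B3 + j \<and> B2 + x \<noteq> B4 + (sp + 1) \<and> 24 \<le> B2 + x"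
    "\<forall>k\<le>sp. B4 + k \<noteq> B3 + j \<and> B4 + k \<noteq> B4 + (sp + 1) \<and> 24 \<le> B4 + k"
    "\<forall>x<j. B3 + x \<noteq> B3 + j \<and> B3 + x \<noteq> B4 + (sp + 1) \<and> 24 \<le> B3 + x"
    using bases j p sp by auto
  {
    assume lt: "b (S sp) < b j"
    have "0 < sp" by (rule scan_pop(1)[OF inv j lt])
    show "wp scan_body (scan_mem p j cur' (sp - 1) S T) m"
    proof (rule eff(1)[OF lt])
      fix m' :: "nat \<Rightarrow> real"
      assume same: "\<forall>x. x \<notin> {1, 6, 12, 14, 15, 16, 17, 18} \<longrightarrow> m' x = m x"
        and new: "m' 6 = cur'" "m' 12 = real sp - 1"
      have hi: "m' x = m x" if "24 \<le> x" for x using same that by simp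
      have "\<forall>k\<le>sp. m' (B4 + k) = real (S k)" "\<forall>x. p \<le> x \<and> x < j \<longrightarrow> m' (B3 + x) = T x"
        "weights m'" "coeffs m'"
        using mem sets hi unfolding scan_mem_def weights_def coeffs_def by simp_all
      moreover have "real (sp - 1) = real sp - 1" using \<open>0 < sp\<close> by simp
      moreover have "frame m'" "m' 5 = real p" "m' 13 = real p + real n" "m' 4 = real j"
        using mem same unfolding scan_mem_def frame_def by simp_all
      ultimately show "scan_mem p j cur' (sp - 1) S T m'"
        using new unfolding scan_mem_def by simp
    qed
  }
  {
    assume ge: "b j \<le> b (S sp)"
    show "wp scan_body (scan_mem p (j + 1) 0 (sp + 1) (S(sp + 1 := j)) (T(j := cur'))) m"
    proof (rule eff(2)[OF ge])
      fix m' :: "nat \<Rightarrow> real"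
      assume same: "\<forall>x. x \<notin> {1, 4, 6, 12, 14, 15, 16, 17, 18, B3 + j, B4 + (sp + 1)} \<longrightarrow> m' x = m x"
        and new: "m' 4 = real j + 1" "m' 6 = 0" "m' 12 = real sp + 1" "m' (B3 + j) = cur'" "m' (B4 + (sp + 1)) = real j"
      have hi: "m' x = m x" if "24 \<le> x" "x \<noteq> B3 + j" "x \<noteq> B4 + (sp + 1)" for x using same that by simp
      have lo: "m' x = m x" if "x \<in> {0, 2, 3, 5, 7, 8, 9, 10, 11, 13}" for x
        using same that bases by auto
      have "\<forall>k\<le>sp. m' (B4 + k) = real ((S(sp + 1 := j)) k)" "\<forall>x. p \<le> x \<and> x < j \<longrightarrow> m' (B3 + x) = (T(j := cur')) x"
        "weights m'" "coeffs m'"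
        using mem sets hi unfolding scan_mem_def weights_def coeffs_def by simp_all
      then have "\<forall>k\<le>sp + 1. m' (B4 + k) = real ((S(sp + 1 := j)) k)" "\<forall>x. p \<le> x \<and> x < j + 1 \<longrightarrow> m' (B3 + x) = (T(j := cur')) x"
        "weights m'" "coeffs m'"
        using new by (simp_all add: le_Suc_eq less_Suc_eq)
      moreover have "frame m'" "m' 5 = real p" "m' 13 = real p + real n"
        using mem lo unfolding scan_mem_def frame_def by simp_all
      ultimately show "scan_mem p (j + 1) 0 (sp + 1) (S(sp + 1 := j)) (T(j := cur')) m'"
        using new(1-3) unfolding scan_mem_def by simp
    qed
  }
qed

lemma scan_loop:
  assumes "scan_mem p (p + 1) 0 0 (\<lambda>_. p) (\<lambda>_. 0) m"
  shows "terminates (While 4 13 scan_body) (70 * n + 2)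
    (\<lambda>m. \<exists>T. greedy_angles n (leaf_coeff w) p (p + n + 1) T \<and> scan_done p T m) m"
proof -
  define J where "J = (\<lambda>(j, cur, sp, S, T) m. scan_inv j cur sp S T \<and> scan_mem p j cur sp S T m)"
  \<comment> \<open>The amortizing potential: a push loses 2 by advancing \<open>j\<close> and gains
    1 by the new entry, a pop loses 1. It starts at \<open>2 * n\<close>, so the scan is
    linear.\<close>
  define f where "f = (\<lambda>(j, cur :: real, sp :: nat, S :: nat \<Rightarrow> nat, T :: nat \<Rightarrow> real). 2 * (p + n + 1 - j) + sp)"
  define s0 :: "nat \<times> real \<times> nat \<times> (nat \<Rightarrow> nat) \<times> (nat \<Rightarrow> real)" where "s0 = (p + 1, 0, 0, \<lambda>_. p, \<lambda>_. 0)"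
  have "terminates (While 4 13 scan_body) ((cost scan_body + 2) * f s0 + 2)
    (\<lambda>m. \<exists>T. greedy_angles n (leaf_coeff w) p (p + n + 1) T \<and> scan_done p T m) m"
  proof (rule terminates_While[of J])
    fix s m assume "J s m" and le: "m 4 \<le> m 13"
    then obtain j cur sp S T where s: "s = (j, cur, sp, S, T)"
      and inv: "scan_inv j cur sp S T" and mem: "scan_mem p j cur sp S T m"
      by (cases s) (auto simp: J_def)
    have "real j \<le> real (p + n)" using le mem by (simp add: scan_mem_def)
    then have j: "j \<le> p + n" by (simp only: of_nat_le_iff)
    define cur' where "cur' = max cur (T (S sp) + touch_angle (b (S sp)) (b j))"
    show "terminates scan_body (cost scan_body) (\<lambda>m'. \<exists>s'. J s' m' \<and> f s' < f s) m"
    proof (cases "b (S sp) < b j")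
      case True
      note body = terminates_loop_free[OF scan_body(1)[OF inv mem le True]]
      show ?thesis
        using scan_pop[OF inv j True]
        by (intro terminates_mono[OF body] exI[of _ "(j, cur', sp - 1, S, T)"])
          (auto simp: J_def f_def s cur'_def)
    next
      case False
      then have ge: "b j \<le> b (S sp)" by simp
      note body = terminates_loop_free[OF scan_body(2)[OF inv mem le ge]]
      show ?thesis
        using scan_push[OF inv j ge] j
        by (intro terminates_mono[OF body] exI[of _ "(j + 1, 0, sp + 1, S(sp + 1 := j), T(j := cur'))"])
          (auto simp: J_def f_def s cur'_def)
    qed
  next
    show "J s0 m" using assms by (simp add: J_def s0_def scan_inv_init[simplified])
  next
    fix s m assume "J s m" and nle: "\<not> m 4 \<le> m 13"
    then obtain j cur sp S T where inv: "scan_inv j cur sp S T" and mem: "scan_mem p j cur sp S T m"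
      by (cases s) (auto simp: J_def)
    have "\<not> real j \<le> real (p + n)" using nle mem by (simp add: scan_mem_def)
    then have j: "p + n < j" by (simp only: of_nat_le_iff not_le)
    have "scan_done p T m" using mem j by (auto simp: scan_mem_def scan_done_def)
    then show "\<exists>T. greedy_angles n (leaf_coeff w) p (p + n + 1) T \<and> scan_done p T m"
      using scan_inv_done[OF inv j] by blast
  qed
  then show ?thesis by (rule terminates_mono) (auto simp: scan_body_def f_def s0_def)
qed

definition angle_at :: "(nat \<Rightarrow> real) \<Rightarrow> nat \<Rightarrow> real" where
  "angle_at T i = T (if p \<le> i then i else i + n) * (2 * pi / T (p + n))"

definition out_x :: "(nat \<Rightarrow> real) \<Rightarrow> nat \<Rightarrow> real" where
  "out_x T i = (if i = 0 then 0 else (w 0 + w i) * cos (angle_at T i))"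

definition out_y :: "(nat \<Rightarrow> real) \<Rightarrow> nat \<Rightarrow> real" where
  "out_y T i = (if i = 0 then 0 else (w 0 + w i) * sin (angle_at T i))"

definition output_cells :: "nat \<Rightarrow> (nat \<Rightarrow> real) \<Rightarrow> nat \<Rightarrow> (nat \<Rightarrow> real) \<Rightarrow> bool" where
  "output_cells B T i m \<longleftrightarrow>
     (\<forall>x<i. m (B + 3 * x + 1) = out_x T x \<and> m (B + 3 * x + 2) = out_y T x \<and> m (B + 3 * x + 3) = w x)"

text \<open>Cell 13 is overridden so that \<open>scan_done\<close> can be reused for the other
  cells.\<close>

definition output_mem :: "(nat \<Rightarrow> real) \<Rightarrow> nat \<Rightarrow> (nat \<Rightarrow> real) \<Rightarrow> bool" where
  "output_mem T i m \<longleftrightarrow> scan_done p T (m(13 := real p + real n)) \<and> m 20 = 2 * pi / T (p + n) \<and>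
     1 \<le> i \<and> i \<le> n + 1 \<and> m 4 = real i \<and> m 12 = real (B5 + 3 * i) \<and> output_cells B5 T i m"

lemma output_init:
  assumes "scan_done p T m" and "m 14 = T (p + n)" "m 20 = 2 * pi" "T (p + n) \<noteq> 0"
  shows "wp output_init (output_mem T 1) m"
  using assms bases n p
  unfolding output_init_def output_mem_def scan_done_def frame_def weights_def output_cells_def out_x_def out_y_def
  by (simp add: numeral_eq_Suc)

lemma output_body:
  assumes mem: "output_mem T i m" and le: "m 4 \<le> m 2"
  shows "wp output_body (output_mem T (i + 1)) m"
proof -
  have i: "i \<le> n" "1 \<le> i" using mem le by (auto simp: output_mem_def scan_done_def frame_def)
  define q where "q = B5 + 3 * i"
  have regs: "m 0 = real B1" "m 2 = real n" "m 3 = 1" "m 7 = w 0" "m 9 = real B3" "m 4 = real i" "m 5 = real p"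
    "m 12 = real q" "m 20 = 2 * pi / T (p + n)" "m (B1 + i + 1) = w i"
    "m (B3 + (if p \<le> i then i else i + n)) = T (if p \<le> i then i else i + n)"
    using mem i bases p unfolding output_mem_def scan_done_def frame_def weights_def q_def by auto
  have B: "24 \<le> B1" "24 \<le> B3" "24 \<le> q" using bases by (auto simp: q_def)
  show ?thesis
  proof (rule wp_output_body[OF regs B, folded angle_at_def])
    fix m' :: "nat \<Rightarrow> real"
    assume same: "\<forall>x. x \<notin> {1, 4, 12, 14, 15, 16, 17, 18, q + 1, q + 2, q + 3} \<longrightarrow> m' x = m x"
      and new: "m' 4 = real i + 1" "m' 12 = real q + 3" "m' (q + 1) = (w 0 + w i) * cos (angle_at T i)"
        "m' (q + 2) = (w 0 + w i) * sin (angle_at T i)" "m' (q + 3) = w i"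
    have hi: "m' x = m x" if "24 \<le> x" "x \<le> q" for x using same that by simp
    have lo: "m' x = m x" if "x \<in> {0, 2, 3, 5, 7, 8, 9, 10, 11, 20}" for x
      using same that bases by (auto simp: q_def)
    have "scan_done p T (m'(13 := real p + real n))"
      using mem hi lo bases p n unfolding output_mem_def scan_done_def frame_def weights_def q_def by simp
    moreover have "output_cells B5 T i m'"
      using mem hi bases unfolding output_mem_def output_cells_def q_def by simp
    then have "output_cells B5 T (i + 1) m'"
      using new(3-5) i unfolding output_cells_def q_def out_x_def out_y_def by (auto simp: less_Suc_eq)
    ultimately show "output_mem T (i + 1) m'"
      using new(1,2) lo[of 20] mem i unfolding output_mem_def q_def by simp
  qed
qed

lemma output_loop:
  assumes "output_mem T 1 m"
  shows "terminates (While 4 2 output_body) (24 * n + 2) (output_mem T (n + 1)) m"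
proof -
  have "terminates (While 4 2 output_body) ((cost output_body + 2) * (n + 1 - 1) + 2) (output_mem T (n + 1)) m"
  proof (rule terminates_While[of "output_mem T" _ _ _ _ "\<lambda>i. n + 1 - i", OF _ assms])
    fix i m assume i: "output_mem T i m" and le: "m 4 \<le> m 2"
    then have "i \<le> n" by (auto simp: output_mem_def scan_done_def frame_def)
    then show "terminates output_body (cost output_body) (\<lambda>m'. \<exists>i'. output_mem T i' m' \<and> n + 1 - i' < n + 1 - i) m"
      by (intro terminates_mono[OF terminates_loop_free[OF output_body[OF i le]]] exI[of _ "i + 1"]) auto
  next
    fix i m assume mem: "output_mem T i m" and "\<not> m 4 \<le> m 2"
    then have "i = n + 1" by (auto simp: output_mem_def scan_done_def frame_def)
    with mem show "output_mem T (n + 1) m" by simp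
  qed
  then show ?thesis by (rule terminates_mono) (auto simp: output_body_def)
qed

end

section \<open>Moving the output into place\<close>

definition copy_mem :: "(nat \<Rightarrow> real) \<Rightarrow> nat \<Rightarrow> (nat \<Rightarrow> real) \<Rightarrow> bool" where
  "copy_mem R i m \<longleftrightarrow> m 3 = 1 \<and> m 11 = real B5 \<and> m 4 = real i \<and> m 13 = 3 * real n + 3 \<and> 24 \<le> i \<and>
     (\<forall>c. 24 \<le> c \<and> c < i \<and> c \<le> 3 * n + 3 \<longrightarrow> m c = R c) \<and>
     (\<forall>c. 1 \<le> c \<and> c \<le> 3 * n + 3 \<longrightarrow> m (B5 + c) = R c)"

lemma copy_body:
  assumes "copy_mem R i m" "m 4 \<le> m 13"
  shows "wp copy_body (copy_mem R (i + 1)) m"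
proof -
  have i: "i \<le> 3 * n + 3" "24 \<le> i" using assms by (auto simp: copy_mem_def)
  show ?thesis
    using assms i bases n unfolding copy_mem_def copy_body_def
    by (auto simp: less_Suc_eq)
qed

lemma copy_loop:
  assumes "copy_mem R 24 m"
  shows "terminates (While 4 13 copy_body) (18 * n + 26) (\<lambda>m. \<exists>i>3 * n + 3. copy_mem R i m) m"
proof -
  have "terminates (While 4 13 copy_body) ((cost copy_body + 2) * (3 * n + 4 - 24) + 2) (\<lambda>m. \<exists>i>3 * n + 3. copy_mem R i m) m"
  proof (rule terminates_While[of "copy_mem R" _ _ _ _ "\<lambda>i. 3 * n + 4 - i", OF _ assms])
    fix i m assume i: "copy_mem R i m" and le: "m 4 \<le> m 13"
    then have "i \<le> 3 * n + 3" by (auto simp: copy_mem_def)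
    then show "terminates copy_body (cost copy_body) (\<lambda>m'. \<exists>i'. copy_mem R i' m' \<and> 3 * n + 4 - i' < 3 * n + 4 - i) m"
      by (intro terminates_mono[OF terminates_loop_free[OF copy_body[OF i le]]] exI[of _ "i + 1"]) auto
  next
    fix i m assume mem: "copy_mem R i m" and "\<not> m 4 \<le> m 13"
    then have "3 * n + 3 < i" by (auto simp: copy_mem_def)
    with mem show "\<exists>i>3 * n + 3. copy_mem R i m" by blast
  qed
  then show ?thesis by (rule terminates_mono) (auto simp: copy_body_def)
qed

text \<open>\<open>R\<close> gives the wanted contents by final address. Cells from 24 on were
  copied by the loop, those from 2 to 23 are restored from the output array, and cell 1 comes
  last.\<close>

lemma finish_code:
  assumes mem: "copy_mem R i m" and i: "3 * n + 3 < i"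
  shows "wp finish_code (\<lambda>m. m 0 = 1 \<and> (\<forall>c. 1 \<le> c \<and> c \<le> 3 * n + 3 \<longrightarrow> m c = R c)) m"
proof -
  let ?m = "m(0 := real B5)"
  let ?final = "block [Const 1 1, Add 1 1 0, Load 1 1, Const 0 1]"
  let ?Q = "\<lambda>m. m 0 = 1 \<and> (\<forall>c. 1 \<le> c \<and> c \<le> 3 * n + 3 \<longrightarrow> m c = R c)"
  have "wp (restore_regs (rev [2..<24])) (wp ?final ?Q) ?m"
  proof (rule wp_restore_regs[where B = B5])
    show "?m 0 = real B5" by simp
    show "\<forall>i\<in>set (rev [2..<24]). 2 \<le> i \<and> i < B5" using bases by auto
    show "distinct (rev [2..<24])" by simp
    fix m' assume restored: "\<forall>i\<in>set (rev [2..<24]). m' i = ?m (B5 + i)"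
      and other: "\<forall>x. x \<noteq> 1 \<longrightarrow> x \<notin> set (rev [2..<24]) \<longrightarrow> m' x = ?m x"
    have "m' 0 = real B5" "m' (B5 + 1) = R 1"
      using other mem bases by (auto simp: copy_mem_def)
    moreover have "m' c = R c" if c: "2 \<le> c" "c \<le> 3 * n + 3" for c
    proof (cases "c < 24")
      case True
      then have "c \<in> set (rev [2..<24])" using c by (simp only: set_rev set_upt) simp
      then have "m' c = ?m (B5 + c)" using restored by blast
      then show ?thesis using mem c bases by (simp add: copy_mem_def)
    next
      case False
      then show ?thesis using other mem c i by (auto simp: copy_mem_def)
    qed
    ultimately show "wp ?final ?Q m'"
      using bases by (auto simp: add.commute)
  qed
  moreover have "m 11 = real B5" using mem by (simp add: copy_mem_def)
  ultimately show ?thesis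
    unfolding finish_code_def by (simp only: wp.simps block.simps wp_instr.simps)
qed

lemma emit_code:
  assumes cycle: "leaf_cycle n (leaf_coeff w) p" and greedy: "greedy_angles n (leaf_coeff w) p (p + n + 1) T"
    and mem: "scan_done p T m" "m 14 = T (p + n)" "m 20 = 2 * pi" and lt: "T (p + n) < 2 * pi"
  shows "terminates emit_code (42 * n + 120)
    (\<lambda>m. m 0 = 1 \<and> (let c = (\<lambda>i. Complex (m (3*i+1)) (m (3*i+2))); r = (\<lambda>i. m (3*i+3))
         in star_wdcr n w c r \<and> respects_embedding n c r)) m"
proof -
  interpret leaf_cycle n "leaf_coeff w" p by (rule cycle)
  define Q where "Q = (\<lambda>m. m 0 = 1 \<and> (let c = (\<lambda>i. Complex (m (3*i+1)) (m (3*i+2))); r = (\<lambda>i. m (3*i+3))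
         in star_wdcr n w c r \<and> respects_embedding n c r))"
  define l where "l = 2 * pi / T (p + n)"
  let ?\<theta> = "\<lambda>i. if p \<le> i then l * T i else l * T (i + n) - 2 * pi"
  have "T (p + n) \<noteq> 0" using greedy_end_pos[OF greedy] by simp
  \<comment> \<open>The machine takes the leaves before \<open>p\<close> one turn later, which
    yields the same points.\<close>
  have "cis (x - 2 * pi) = cis x" for x
    by (simp add: complex_eq_iff cos_diff sin_diff)
  moreover have "angle_at p T i = l * T (if p \<le> i then i else i + n)" for i
    by (simp add: angle_at_def[OF cycle] l_def)
  ultimately have cis: "cis (angle_at p T i) = cis (?\<theta> i)" for i
    by simp
  have sep: "separated_angles n (leaf_coeff w) ?\<theta>"
    unfolding l_def by (rule separated_scaled_greedy[OF greedy lt])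
  have correct: "Q m" if "m 0 = 1" and "output_cells p 0 T (n + 1) m" for m
  proof -
    have cells: "m (3 * i + 1) = out_x p T i" "m (3 * i + 2) = out_y p T i" "m (3 * i + 3) = w i" if "i \<le> n" for i
      using \<open>output_cells p 0 T (n + 1) m\<close> that by (auto simp: output_cells_def[OF cycle])
    let ?c = "\<lambda>i. Complex (m (3*i+1)) (m (3*i+2))" and ?r = "\<lambda>i. m (3*i+3)"
    have "?c 0 = 0" using cells[of 0] by (simp add: out_x_def[OF cycle] out_y_def[OF cycle] complex_eq_iff)
    moreover have "?c i = of_real (w 0 + w i) * cis (?\<theta> i)" if "1 \<le> i" "i \<le> n" for i
      using cells[of i] that unfolding cis[symmetric]
      by (simp add: out_x_def[OF cycle] out_y_def[OF cycle] complex_eq_iff)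
    ultimately have "star_wdcr n w ?c ?r" "respects_embedding n ?c ?r"
      using star_rep_of_separated_angles[OF _ sep, of ?c ?r] w cells(3) by auto
    then show ?thesis using \<open>m 0 = 1\<close> by (simp add: Q_def Let_def)
  qed
  have fin: "terminates finish_code (cost finish_code) Q m" if "copy_mem R i m" "3 * n + 3 < i"
    "output_cells p 0 T (n + 1) R" for R i m
  proof (rule terminates_mono[OF terminates_loop_free[OF finish_code[OF that(1,2)]] order_refl])
    fix m assume m: "m 0 = 1 \<and> (\<forall>c. 1 \<le> c \<and> c \<le> 3 * n + 3 \<longrightarrow> m c = R c)"
    then have "output_cells p 0 T (n + 1) m"
      using that(3) by (auto simp: output_cells_def[OF cycle])
    then show "Q m" using correct m by blast
  qed
  have copy: "terminates (copy_init ;; While 4 13 copy_body ;; finish_code)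
      (cost copy_init + (18 * n + 26 + cost finish_code)) Q m"
    if mem: "output_mem p T (n + 1) m" for m
  proof -
    define R where "R c = m (B5 + c)" for c
    have R: "output_cells p 0 T (n + 1) R"
      using mem by (simp add: output_mem_def[OF cycle] output_cells_def[OF cycle] R_def add.assoc)
    have "wp copy_init (copy_mem R 24) m"
      using mem bases unfolding copy_init_def copy_mem_def output_mem_def[OF cycle] scan_done_def frame_def R_def
      by simp
    note init = terminates_loop_free[OF this]
    show ?thesis
      by (rule terminates_Seq[OF init], erule terminates_Seq[OF copy_loop]) (blast intro: fin[OF _ _ R])
  qed
  have "terminates emit_code
      (cost output_init + (24 * n + 2 + (cost copy_init + (18 * n + 26 + cost finish_code)))) Q m"
    unfolding emit_code_def
    by (rule terminates_Seq[OF terminates_loop_free[OF output_init[OF cycle mem \<open>T (p + n) \<noteq> 0\<close>]]],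
      erule terminates_Seq[OF output_loop[OF cycle]], erule copy)
  then show ?thesis
    unfolding Q_def by (rule terminates_mono) (auto simp: output_init_def copy_init_def finish_code_def cost_restore_regs)
qed

lemma setup_code:
  assumes B: "B1 = 64 * n" "B2 = 2 * B1" "B3 = 3 * B1" "B4 = 4 * B1" "B5 = 5 * B1"
    and m: "m 0 = real B1" "m B1 = w 0" "\<forall>c. 2 \<le> c \<and> c \<le> n + 1 \<longrightarrow> m c = w (c - 1)"
  shows "wp (save_regs [2..<24]) (wp setup_code (shift_mem 24)) m"
proof (rule wp_save_regs[where B = B1])
  show "\<forall>i\<in>set [2..<24]. 2 \<le> i \<and> i < B1" using bases by auto
  fix m' assume saved: "\<forall>i\<in>set [2..<24]. m' (B1 + i) = m i"
    and other: "\<forall>x. x \<noteq> 1 \<longrightarrow> x \<notin> (+) B1 ` set [2..<24] \<longrightarrow> m' x = m x"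
  have regs: "m' 0 = real B1" "m' B1 = w 0"
    using other m bases by auto
  have lo: "m' (B1 + c) = w (c - 1)" if "2 \<le> c" "c < 24" "c \<le> n + 1" for c
  proof -
    have "c \<in> set [2..<24]" using that by (simp only: set_upt) simp
    then have "m' (B1 + c) = m c" using saved by blast
    then show ?thesis using m that by simp
  qed
  have hi: "m' c = w (c - 1)" if "24 \<le> c" "c \<le> n + 1" for c
  proof -
    have "c \<notin> (+) B1 ` set [2..<24]" using that bases by auto
    then have "m' c = m c" using other that by simp
    then show ?thesis using m that by simp
  qed
  show "wp setup_code (shift_mem 24) m'"
    using regs lo hi bases unfolding setup_code_def shift_mem_def frame_def by simp (simp add: B)
qed (use m in simp_all)

text \<open>The phases are composed backwards: each local fact covers the program from one phase to
  its end.\<close>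

lemma leaves_code:
  assumes B: "B1 = 64 * n" "B2 = 2 * B1" "B3 = 3 * B1" "B4 = 4 * B1" "B5 = 5 * B1"
    and m: "m 0 = real B1" "m B1 = w 0" "\<forall>c. 2 \<le> c \<and> c \<le> n + 1 \<longrightarrow> m c = w (c - 1)"
  shows "terminates leaves_code (136 * n + 300) (star_output_correct n w) m"
proof -
  have decide: "terminates (decide_init ;; Cond 20 14 (block [Const 0 0]) emit_code)
      (cost decide_init + (42 * n + 120 + 2)) (star_output_correct n w) m"
    if cycle: "leaf_cycle n (leaf_coeff w) p" and greedy: "greedy_angles n (leaf_coeff w) p (p + n + 1) T"
      and mem: "scan_done p T m" for p T m
  proof -
    interpret leaf_cycle n "leaf_coeff w" p by (rule cycle)
    have "wp decide_init (\<lambda>m. scan_done p T m \<and> m 14 = T (p + n) \<and> m 20 = 2 * pi) m"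
      using mem bases p n unfolding decide_init_def scan_done_def frame_def weights_def
      by simp
    note init = terminates_loop_free[OF this]
    have branch: "terminates (Cond 20 14 (block [Const 0 0]) emit_code) (42 * n + 120 + 2) (star_output_correct n w) m"
      if m: "scan_done p T m" "m 14 = T (p + n)" "m 20 = 2 * pi" for m
    proof (rule terminates_Cond)
      assume "m 20 \<le> m 14"
      have "\<not> has_star_rep n w"
      proof
        assume "has_star_rep n w"
        then obtain \<theta> where "separated_angles n (leaf_coeff w) \<theta>"
          using separated_angles_of_star_rep[of n w] w unfolding has_star_rep_def by blast
        then have "T (p + n) < 2 * pi" by (rule greedy_end_less[OF greedy])
        then show False using \<open>m 20 \<le> m 14\<close> m by simp
      qed
      then have "wp (block [Const 0 0]) (star_output_correct n w) m"
        by (simp add: star_output_correct_def)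
      from terminates_loop_free[OF this]
      show "terminates (block [Const 0 0]) (42 * n + 120) (star_output_correct n w) m"
        by (rule terminates_mono) auto
    next
      assume "\<not> m 20 \<le> m 14"
      then have "T (p + n) < 2 * pi" using m by simp
      from emit_code[OF cycle greedy m this]
      show "terminates emit_code (42 * n + 120) (star_output_correct n w) m"
        by (rule terminates_mono) (auto simp: star_output_correct_def has_star_rep_def Let_def)
    qed
    show ?thesis
      by (rule terminates_Seq[OF init]) (blast intro: branch)
  qed
  have scan: "terminates (scan_init ;; While 4 13 scan_body ;; decide_init ;; Cond 20 14 (block [Const 0 0]) emit_code)
      (cost scan_init + (70 * n + 2 + (cost decide_init + (42 * n + 120 + 2)))) (star_output_correct n w) m"
    if cycle: "leaf_cycle n (leaf_coeff w) p" and mem: "coeff_done p m" for p m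
    by (rule terminates_Seq[OF terminates_loop_free[OF scan_init[OF cycle mem]]],
      erule terminates_Seq[OF scan_loop[OF cycle]]) (blast intro: decide[OF cycle])
  have coeff: "terminates (coeff_init ;; While 4 2 coeff_body ;;
      scan_init ;; While 4 13 scan_body ;; decide_init ;; Cond 20 14 (block [Const 0 0]) emit_code)
      (cost coeff_init + (18 * n + 2 +
        (cost scan_init + (70 * n + 2 + (cost decide_init + (42 * n + 120 + 2)))))) (star_output_correct n w) m"
    if "frame m" "weights m" for m
  proof -
    have "wp coeff_init (coeff_mem 1) m"
      using that bases n unfolding coeff_init_def coeff_mem_def frame_def weights_def by simp
    from terminates_loop_free[OF this] show ?thesis
      by (rule terminates_Seq, elim terminates_Seq[OF coeff_loop]) (blast intro: scan)
  qed
  have "terminates leaves_code (cost (save_regs [2..<24]) + (cost setup_code + (6 * n + 14 +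
      (cost coeff_init + (18 * n + 2 +
        (cost scan_init + (70 * n + 2 + (cost decide_init + (42 * n + 120 + 2))))))))) (star_output_correct n w) m"
    unfolding leaves_code_def
    by (rule terminates_Seq[OF terminates_loop_free[OF setup_code[OF B m]]],
      erule terminates_Seq[OF terminates_loop_free], erule terminates_Seq[OF shift_loop]) (blast intro: coeff)
  then show ?thesis
    by (rule terminates_mono)
      (auto simp: cost_save_regs setup_code_def coeff_init_def scan_init_def decide_init_def)
qed

end

section \<open>The complete program\<close>

lemma star_code:
  assumes w: "\<forall>i\<le>n. 0 < w i"
  shows "terminates star_code (136 * n + 310) (star_output_correct n w) (snd (star_input n w))"
proof -
  let ?init = "block [Add 0 0 0, Add 0 0 0, Add 0 0 0, Add 0 0 0, Add 0 0 0, Add 0 0 0, Store 0 1, Const 1 0]"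
  let ?m = "snd (star_input n w)"
  define m1 where "m1 = ?m(0 := 64 * real n, 64 * n := w 0, 1 := 0)"
  have "wp ?init (\<lambda>m. m = m1) ?m"
    using cell_simps(1)[of "64 * n"] of_nat_in_Nats[of "64 * n", where 'a = real]
    by (simp add: star_input_def m1_def del: of_nat_in_Nats cell_simps)
  note init = terminates_loop_free[OF this]
  have branch: "terminates (Cond 2 1 (block [Copy 3 0, Const 0 1]) leaves_code) (136 * n + 300 + 2) (star_output_correct n w) m1"
  proof (rule terminates_Cond)
    assume le: "m1 2 \<le> m1 1"
    have "n = 0"
    proof (rule ccontr)
      assume "n \<noteq> 0"
      then have "m1 2 = w 1" "m1 1 = 0" by (auto simp: m1_def star_input_def)
      then show False using le w \<open>n \<noteq> 0\<close> by (metis One_nat_def Suc_leI gr0I not_le)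
    qed
    \<comment> \<open>A lone centre may lie anywhere, so besides the answer only its radius in cell
      3 has to be set.\<close>
    have rep: "star_wdcr 0 w c r" "respects_embedding 0 c r" if "r 0 = w 0" for c r
      using that by (auto simp: star_wdcr_def respects_embedding_def intro!: exI[of _ 1])
    have "has_star_rep 0 w" using rep[of w] unfolding has_star_rep_def by auto
    then have "wp (block [Copy 3 0, Const 0 1]) (star_output_correct n w) m1"
      using \<open>n = 0\<close> by (simp add: star_output_correct_def Let_def rep m1_def)
    from terminates_loop_free[OF this]
    show "terminates (block [Copy 3 0, Const 0 1]) (136 * n + 300) (star_output_correct n w) m1"
      by (rule terminates_mono) auto
  next
    assume le: "\<not> m1 2 \<le> m1 1"
    have n: "1 \<le> n"
    proof (rule ccontr)
      assume "\<not> 1 \<le> n"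
      then show False using le by (simp add: m1_def star_input_def)
    qed
    interpret star_memory n w "64 * n" "2 * (64 * n)" "3 * (64 * n)" "4 * (64 * n)" "5 * (64 * n)"
      using n w by unfold_locales auto
    show "terminates leaves_code (136 * n + 300) (star_output_correct n w) m1"
      by (rule leaves_code) (use n in \<open>auto simp: m1_def star_input_def\<close>)
  qed
  have "terminates star_code (cost ?init + (136 * n + 300 + 2)) (star_output_correct n w) ?m"
    unfolding star_code_def
    by (rule terminates_Seq[OF init]) (use branch in simp)
  then show ?thesis by (rule terminates_mono) auto
qed

theorem theorem4:
  shows "\<exists>(P :: instr list) (C :: nat). \<forall>(n :: nat) (w :: nat \<Rightarrow> real).
           (\<forall>i\<le>n. 0 < w i) \<longrightarrow>
           (\<exists>k s. k \<le> C * (n + 1) \<and> exec P k (star_input n w) = Some s \<and>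
                  halted P s \<and> star_output_correct n w (snd s))"
\<comment> \<open>The constant 310 bounds both coefficients of \<open>136 * n + 310\<close>.\<close>
proof (rule exI[of _ "compile 0 star_code"], rule exI[of _ 310], intro allI impI)
  fix n :: nat and w :: "nat \<Rightarrow> real"
  assume "\<forall>i\<le>n. 0 < w i"
  from star_code[OF this] obtain t m where
    t: "t \<le> 136 * n + 310" "big_step star_code (snd (star_input n w)) t m" "star_output_correct n w m"
    unfolding terminates_def by blast
  have "exec (compile 0 star_code) t (star_input n w) = Some (length (compile 0 star_code), m)"
    using compile_correct[OF t(2), of "[]" "[]"] by (simp add: star_input_def)
  then show "\<exists>k s. k \<le> 310 * (n + 1) \<and> exec (compile 0 star_code) k (star_input n w) = Some s \<and>
      halted (compile 0 star_code) s \<and> star_output_correct n w (snd s)"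
    using t by (intro exI[of _ t] exI[of _ "(length (compile 0 star_code), m)"]) (auto simp: halted_def)
qed

end
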